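(* Let $N=1$ and let $g\in C^1([0,+\infty))$ satisfy $g(0)=0$, $g(s)>0$ for $s>0$. Suppose there are $\alpha,\beta\in(2,+\infty)$ and $\mu_1,\mu_2>0$ such that $\lim_{s\to 0^+}\frac{g'(s)}{s^{\alpha-2}}=\mu_1(\alpha-1)$ and $\lim_{s\to+\infty}\frac{g'(s)}{s^{\beta-2}}=\mu_2(\beta-1)$. For any $\lambda>0$, let $u_\lambda$ denote the unique nontrivial even solution in $H^1(\mathbb{R})$ of $-u''+\lambda u=g(u)$ in $\mathbb{R}$. Then the map $\lambda\mapsto u_\lambda$ is continuous from $(0,+\infty)$ to $H^1(\mathbb{R})$. In particular, $\{(\lambda,u_\lambda):\lambda\in(0,+\infty)\}$ is connected.
   Context: $g$ is extended to $\mathbb{R}$ by $g(s)=0$ for $s\le 0$. The paper takes as known that for every $\lambda>0$ the equation $-u''+\lambda u=g(u)$ has in $H^1(\mathbb{R})$ a nontrivial solution, unique up to translation, which, after a translation of the origin, is positive, even and decreasing on $[0,+\infty)$; $u_\lambda$ is this even representative. Connectedness is in $(0,+\infty)\times H^1(\mathbb{R})$. *)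

theory Defs
  imports "HOL-Analysis.Analysis"
begin

section \<open>The Sobolev space $H^1$ of the real line\<close>

text \<open>Test functions: once continuously differentiable with compact support; by mollification they
  yield the same weak derivatives and weak solutions as smooth ones.\<close>

definition C1c :: "(real \<Rightarrow> real) set" where
  "C1c = {\<phi>. \<phi> C1_differentiable_on UNIV \<and> compact (closure {x. \<phi> x \<noteq> 0})}"

definition L2 :: "(real \<Rightarrow> real) set" where
  "L2 = {u. u \<in> borel_measurable lborel \<and> integrable lborel (\<lambda>x. (u x)\<^sup>2)}"

text \<open>To be used with \<open>u\<close> and \<open>v\<close> in \<open>L2\<close>, where all the integrals exist.\<close>

definition is_weak_deriv :: "(real \<Rightarrow> real) \<Rightarrow> (real \<Rightarrow> real) \<Rightarrow> bool" where
  "is_weak_deriv u v \<longleftrightarrow>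
     (\<forall>\<phi>\<in>C1c. (LINT x|lborel. u x * deriv \<phi> x) = - (LINT x|lborel. v x * \<phi> x))"

definition H1_funs :: "(real \<Rightarrow> real) set" where
  "H1_funs = {u \<in> L2. \<exists>v\<in>L2. is_weak_deriv u v}"

text \<open>A representative of the weak derivative, which is unique up to null sets
  (\<open>weak_deriv_unique\<close> below).\<close>

definition weak_deriv :: "(real \<Rightarrow> real) \<Rightarrow> real \<Rightarrow> real" where
  "weak_deriv u = (SOME v. v \<in> L2 \<and> is_weak_deriv u v)"

lemma L2_measurable [measurable_dest]: "u \<in> L2 \<Longrightarrow> u \<in> borel_measurable borel"
  by (simp add: L2_def)

lemma L2_sq_integrable: "u \<in> L2 \<Longrightarrow> integrable lborel (\<lambda>x. (u x)\<^sup>2)"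
  by (simp add: L2_def)

lemma L2_mult_integrable:
  assumes u: "u \<in> L2" and v: "v \<in> L2"
  shows "integrable lborel (\<lambda>x. u x * v x)"
proof (rule Bochner_Integration.integrable_bound)
  show "integrable lborel (\<lambda>x. (u x)\<^sup>2 + (v x)\<^sup>2)"
    using u v by (intro Bochner_Integration.integrable_add L2_sq_integrable)
  show "(\<lambda>x. u x * v x) \<in> borel_measurable lborel"
    using L2_measurable[OF u] L2_measurable[OF v] by measurable
  have "\<bar>a * b\<bar> \<le> a\<^sup>2 + b\<^sup>2" for a b :: real
  proof -
    have "2 * \<bar>a * b\<bar> \<le> a\<^sup>2 + b\<^sup>2"
      using sum_squares_bound[of "\<bar>a\<bar>" "\<bar>b\<bar>"] by (simp add: abs_mult)
    thus ?thesis by (smt (verit) zero_le_power2)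
  qed
  thus "AE x in lborel. norm (u x * v x) \<le> norm ((u x)\<^sup>2 + (v x)\<^sup>2)"
    by auto
qed

lemma L2_mult_measurable:
  assumes "u \<in> L2" "v \<in> L2"
  shows "(\<lambda>x. u x * v x) \<in> borel_measurable lborel"
  using L2_measurable[OF assms(1)] L2_measurable[OF assms(2)] by measurable

lemma L2_zero: "(\<lambda>_. 0) \<in> L2"
  by (simp add: L2_def)

lemma L2_scale:
  assumes "u \<in> L2" shows "(\<lambda>x. c * u x) \<in> L2"
  using assms by (auto simp: L2_def power_mult_distrib)

lemma L2_add:
  assumes u: "u \<in> L2" and v: "v \<in> L2" shows "(\<lambda>x. u x + v x) \<in> L2"
proof -
  have "integrable lborel (\<lambda>x. (u x)\<^sup>2 + (v x)\<^sup>2 + 2 * (u x * v x))"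
    by (intro Bochner_Integration.integrable_add integrable_mult_right
        L2_sq_integrable L2_mult_integrable u v)
  moreover have "(\<lambda>x. (u x)\<^sup>2 + (v x)\<^sup>2 + 2 * (u x * v x)) = (\<lambda>x. (u x + v x)\<^sup>2)"
    by (auto simp: power2_sum algebra_simps)
  moreover have "(\<lambda>x. u x + v x) \<in> borel_measurable borel"
    by (intro borel_measurable_add L2_measurable u v)
  ultimately show ?thesis by (simp add: L2_def)
qed

lemma L2_sq_zero_AE:
  assumes u: "u \<in> L2" and z: "(LINT x|lborel. (u x)\<^sup>2) = 0"
  shows "AE x in lborel. u x = 0"
  using integral_nonneg_eq_0_iff_AE[OF L2_sq_integrable[OF u]] z by auto

lemma continuous_compact_support_L2:
  fixes f :: "real \<Rightarrow> real"
  assumes c: "continuous_on UNIV f" and k: "compact (closure {x. f x \<noteq> 0})"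
  shows "f \<in> L2"
proof -
  let ?K = "closure {x. f x \<noteq> 0}"
  have m: "f \<in> borel_measurable borel"
    using c by (rule borel_measurable_continuous_onI)
  have "set_integrable lborel ?K (\<lambda>x. (f x)\<^sup>2)"
    using k by (rule borel_integrable_compact[unfolded set_integrable_def[symmetric]])
      (intro continuous_intros continuous_on_subset[OF c], auto)
  moreover have "(\<lambda>x. indicator ?K x *\<^sub>R (f x)\<^sup>2) = (\<lambda>x. (f x)\<^sup>2)"
    using closure_subset[of "{x. f x \<noteq> 0}"] by (auto simp: fun_eq_iff indicator_def)
  ultimately show ?thesis using m by (simp add: L2_def set_integrable_def)
qed

lemma C1cD:
  assumes "\<phi> \<in> C1c"
  shows "(\<phi> has_real_derivative deriv \<phi> x) (at x)" "continuous_on UNIV (deriv \<phi>)"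
proof -
  obtain D where D: "\<And>x. (\<phi> has_vector_derivative D x) (at x)" "continuous_on UNIV D"
    using assms by (auto simp: C1c_def C1_differentiable_on_def)
  have d: "(\<phi> has_real_derivative D x) (at x)" for x
    using D(1) by (simp add: has_real_derivative_iff_has_vector_derivative)
  hence "deriv \<phi> = D" using DERIV_imp_deriv by blast
  thus "(\<phi> has_real_derivative deriv \<phi> x) (at x)" "continuous_on UNIV (deriv \<phi>)"
    using d D(2) by auto
qed

lemma C1c_L2:
  assumes "\<phi> \<in> C1c" shows "\<phi> \<in> L2"
proof (rule continuous_compact_support_L2)
  show "continuous_on UNIV \<phi>"
    using C1cD(1)[OF assms] by (meson DERIV_continuous_on has_field_derivative_at_within)
qed (use assms in \<open>auto simp: C1c_def\<close>)

lemma C1c_deriv_L2: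
  assumes "\<phi> \<in> C1c" shows "deriv \<phi> \<in> L2"
proof (rule continuous_compact_support_L2[OF C1cD(2)[OF assms]])
  let ?K = "closure {x. \<phi> x \<noteq> 0}"
  have "deriv \<phi> x = 0" if "x \<notin> ?K" for x
  proof -
    have "\<forall>\<^sub>F y in nhds x. y \<in> - ?K"
      using that by (intro eventually_nhds_in_open) auto
    moreover have "\<phi> y = 0" if "y \<in> - ?K" for y
      using that closure_subset[of "{x. \<phi> x \<noteq> 0}"] by auto
    ultimately have "\<forall>\<^sub>F y in nhds x. \<phi> y = 0"
      by (rule eventually_mono)
    hence "deriv \<phi> x = deriv (\<lambda>_. 0) x" by (intro deriv_cong_ev) auto
    thus ?thesis by simp
  qed
  hence "closure {x. deriv \<phi> x \<noteq> 0} \<subseteq> ?K"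
    by (intro closure_minimal) auto
  moreover have "compact ?K" using assms by (simp add: C1c_def)
  ultimately show "compact (closure {x. deriv \<phi> x \<noteq> 0})"
    by (metis closed_closure compact_Int_closed inf.absorb_iff2)
qed

lemma weak_deriv:
  assumes "u \<in> H1_funs"
  shows "weak_deriv u \<in> L2" "is_weak_deriv u (weak_deriv u)"
  using someI_ex[of "\<lambda>v. v \<in> L2 \<and> is_weak_deriv u v"] assms
  by (auto simp: H1_funs_def weak_deriv_def)

lemma H1_funs_L2: "u \<in> H1_funs \<Longrightarrow> u \<in> L2"
  by (simp add: H1_funs_def)

lemma is_weak_deriv_add:
  assumes "u \<in> L2" "v \<in> L2" "u' \<in> L2" "v' \<in> L2" "is_weak_deriv u u'" "is_weak_deriv v v'"
  shows "is_weak_deriv (\<lambda>x. u x + v x) (\<lambda>x. u' x + v' x)"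
  using assms
  by (simp add: is_weak_deriv_def ring_distribs L2_mult_integrable C1c_L2 C1c_deriv_L2)

lemma is_weak_deriv_scale:
  assumes "is_weak_deriv u u'"
  shows "is_weak_deriv (\<lambda>x. c * u x) (\<lambda>x. c * u' x)"
  using assms by (simp add: is_weak_deriv_def mult.assoc)

lemma is_weak_deriv_zero: "is_weak_deriv (\<lambda>_. 0) (\<lambda>_. 0)"
  by (simp add: is_weak_deriv_def)

lemma is_weak_deriv_cong_AE:
  assumes "u \<in> L2" "v \<in> L2" "AE x in lborel. u x = v x" "is_weak_deriv u w"
  shows "is_weak_deriv v w"
proof -
  have "(LINT x|lborel. u x * deriv \<phi> x) = (LINT x|lborel. v x * deriv \<phi> x)" if "\<phi> \<in> C1c" for \<phi>
  proof (rule integral_cong_AE)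
    show "(\<lambda>x. u x * deriv \<phi> x) \<in> borel_measurable lborel"
      "(\<lambda>x. v x * deriv \<phi> x) \<in> borel_measurable lborel"
      using assms that by (intro L2_mult_measurable C1c_deriv_L2; simp)+
  qed (use assms in auto)
  thus ?thesis using assms(4) by (simp add: is_weak_deriv_def)
qed


subsection \<open>Uniqueness of the weak derivative\<close>

definition bump :: "real \<Rightarrow> real \<Rightarrow> real \<Rightarrow> real" where
  "bump a b x = (max 0 (x - a))\<^sup>2 * (max 0 (b - x))\<^sup>2"

lemma max0_sq_deriv:
  fixes x :: real
  shows "((\<lambda>x. (max 0 x)\<^sup>2) has_real_derivative 2 * max 0 x) (at x)"
proof (cases x "0 :: real" rule: linorder_cases)
  case less
  have "((\<lambda>x. 0) has_real_derivative 0) (at x)" by simp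
  moreover have "\<forall>\<^sub>F y in nhds x. y \<in> {..<0}"
    using less by (intro eventually_nhds_in_open) auto
  hence "\<forall>\<^sub>F y in nhds x. (max 0 y)\<^sup>2 = 0" by (rule eventually_mono) auto
  moreover have "2 * max 0 x = 0" using less by simp
  ultimately show ?thesis by (subst DERIV_cong_ev[OF refl])
next
  case greater
  have "((\<lambda>x. x\<^sup>2) has_real_derivative 2 * x) (at x)"
    by (auto intro!: derivative_eq_intros)
  moreover have "\<forall>\<^sub>F y in nhds x. y \<in> {0<..}"
    using greater by (intro eventually_nhds_in_open) auto
  hence "\<forall>\<^sub>F y in nhds x. (max 0 y)\<^sup>2 = y\<^sup>2" by (rule eventually_mono) auto
  moreover have "2 * max 0 x = 2 * x" using greater by simp
  ultimately show ?thesis by (subst DERIV_cong_ev[OF refl])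
next
  case equal
  have "((\<lambda>h::real. (max 0 h)\<^sup>2 / h) \<longlongrightarrow> 0) (at 0)"
  proof (rule Lim_null_comparison)
    show "((\<lambda>h::real. \<bar>h\<bar>) \<longlongrightarrow> 0) (at 0)" by (auto intro!: tendsto_eq_intros)
    show "\<forall>\<^sub>F h::real in at 0. norm ((max 0 h)\<^sup>2 / h) \<le> \<bar>h\<bar>"
      by (auto simp: max_def power2_eq_square)
  qed
  thus ?thesis using equal by (simp add: DERIV_def)
qed

lemma bump_nonneg: "0 \<le> bump a b x"
  by (simp add: bump_def)

lemma bump_pos_iff: "0 < bump a b x \<longleftrightarrow> x \<in> {a<..<b}"
  by (auto simp: bump_def max_def zero_less_mult_iff)

definition cutoff :: "real \<Rightarrow> real \<Rightarrow> real \<Rightarrow> real \<Rightarrow> real" where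
  "cutoff a b n x = n * bump a b x / (1 + n * bump a b x)"

lemma cutoff_C1c:
  assumes n: "0 \<le> n"
  shows "cutoff a b n \<in> C1c"
proof -
  define B' where "B' x = 2 * max 0 (x - a) * (max 0 (b - x))\<^sup>2
    - (max 0 (x - a))\<^sup>2 * (2 * max 0 (b - x))" for x
  have 1: "((\<lambda>x. (max 0 (x - a))\<^sup>2) has_real_derivative 2 * max 0 (x - a)) (at x)" for x
  proof -
    have "((\<lambda>x. x - a) has_real_derivative 1) (at x)" by (auto intro!: derivative_eq_intros)
    from DERIV_chain2[OF max0_sq_deriv this] show ?thesis by simp
  qed
  have 2: "((\<lambda>x. (max 0 (b - x))\<^sup>2) has_real_derivative - (2 * max 0 (b - x))) (at x)" for x
  proof -
    have "((\<lambda>x. b - x) has_real_derivative -1) (at x)" by (auto intro!: derivative_eq_intros)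
    from DERIV_chain2[OF max0_sq_deriv this] show ?thesis by simp
  qed
  have B: "(bump a b has_real_derivative B' x) (at x)" for x
    unfolding bump_def[abs_def] B'_def
    by (rule DERIV_cong[OF DERIV_mult[OF 1 2]]) (simp add: algebra_simps)
  have pos: "0 < 1 + n * bump a b x" for x
    using n bump_nonneg[of a b x] by (simp add: add_pos_nonneg)
  have nz: "1 + n * bump a b x \<noteq> 0" for x
    using pos[of x] by simp
  have D: "(cutoff a b n has_real_derivative
      (n * B' x * (1 + n * bump a b x) - n * bump a b x * (n * B' x)) /
      ((1 + n * bump a b x) * (1 + n * bump a b x))) (at x)" (is "(_ has_real_derivative ?D x) _") for x
    unfolding cutoff_def[abs_def]
    by (intro DERIV_divide nz) (auto intro!: derivative_eq_intros B)
  have cB: "continuous_on UNIV (bump a b)"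
    using B by (meson DERIV_continuous_on has_field_derivative_at_within)
  have "continuous_on UNIV B'"
    unfolding B'_def by (intro continuous_intros)
  hence cD: "continuous_on UNIV ?D"
    using cB nz by (intro continuous_intros) auto
  have C1: "cutoff a b n C1_differentiable_on UNIV"
    unfolding C1_differentiable_on_def
    by (rule exI[of _ ?D], rule conjI[OF ballI cD],
        subst has_real_derivative_iff_has_vector_derivative[symmetric], rule D)
  have "closure {x. cutoff a b n x \<noteq> 0} \<subseteq> {a..b}"
  proof (rule closure_minimal)
    show "{x. cutoff a b n x \<noteq> 0} \<subseteq> {a..b}"
    proof
      fix x assume "x \<in> {x. cutoff a b n x \<noteq> 0}"
      hence "bump a b x \<noteq> 0" by (auto simp: cutoff_def)
      hence "0 < bump a b x" using bump_nonneg[of a b x] by linarith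
      thus "x \<in> {a..b}" by (auto simp: bump_pos_iff)
    qed
  qed simp
  hence "compact (closure {x. cutoff a b n x \<noteq> 0})"
    by (metis closed_closure compact_Icc compact_Int_closed inf.absorb_iff2)
  thus ?thesis using C1 by (simp add: C1c_def)
qed

lemma cutoff_bound:
  assumes n: "0 \<le> n"
  shows "\<bar>cutoff a b n x\<bar> \<le> indicator {a<..<b} x"
proof (cases "x \<in> {a<..<b}")
  case True
  have "0 \<le> n * bump a b x" using n bump_nonneg by simp
  thus ?thesis using True by (simp add: cutoff_def divide_simps)
next
  case False
  hence "bump a b x = 0" using bump_nonneg[of a b x] bump_pos_iff[of a b x] by linarith
  thus ?thesis by (simp add: cutoff_def)
qed

lemma cutoff_tendsto: "(\<lambda>n. cutoff a b (real n) x) \<longlonglongrightarrow> indicator {a<..<b} x"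
proof (cases "x \<in> {a<..<b}")
  case True
  define c where "c = bump a b x"
  have c: "0 < c" using True bump_pos_iff c_def by simp
  have "filterlim (\<lambda>n. 1 + real n * c) at_top sequentially"
    by (intro filterlim_tendsto_add_at_top[OF tendsto_const]
        filterlim_at_top_mult_tendsto_pos[OF tendsto_const c] filterlim_real_sequentially)
  hence "(\<lambda>n. 1 / (1 + real n * c)) \<longlonglongrightarrow> 0"
    by (intro tendsto_divide_0[OF tendsto_const] filterlim_at_top_imp_at_infinity)
  hence "(\<lambda>n. 1 - 1 / (1 + real n * c)) \<longlonglongrightarrow> 1 - 0" by (intro tendsto_intros)
  moreover have "1 - 1 / (1 + real n * c) = cutoff a b (real n) x" for n
  proof -
    have "0 < 1 + real n * c" using c by (simp add: add_pos_nonneg)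
    thus ?thesis by (simp add: cutoff_def c_def[symmetric] field_simps)
  qed
  ultimately show ?thesis using True by simp
next
  case False
  hence "bump a b x = 0" using bump_nonneg[of a b x] bump_pos_iff[of a b x] by linarith
  thus ?thesis using False by (simp add: cutoff_def)
qed

lemma indicator_interval_L2: "(indicator {a<..<b} :: real \<Rightarrow> real) \<in> L2"
proof -
  have "(\<lambda>x. (indicator {a<..<b} x :: real)\<^sup>2) = (indicator {a<..<b} :: real \<Rightarrow> real)"
    by (auto simp: indicator_def fun_eq_iff)
  moreover have "integrable lborel (indicator {a<..<b} :: real \<Rightarrow> real)"
    by (cases "a \<le> b") (auto intro!: integrable_real_indicator)
  ultimately show ?thesis by (auto simp: L2_def)
qed

lemma L2_abs: "u \<in> L2 \<Longrightarrow> (\<lambda>x. \<bar>u x\<bar>) \<in> L2"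
  by (auto simp: L2_def)

lemma integral_interval_zero:
  assumes v: "v \<in> L2" and z: "\<And>\<phi>. \<phi> \<in> C1c \<Longrightarrow> (LINT x|lborel. v x * \<phi> x) = 0"
  shows "(LINT x|lborel. v x * indicator {a<..<b} x) = 0"
proof -
  have "(\<lambda>n. LINT x|lborel. v x * cutoff a b (real n) x)
      \<longlonglongrightarrow> (LINT x|lborel. v x * indicator {a<..<b} x)"
  proof (rule integral_dominated_convergence)
    show "integrable lborel (\<lambda>x. \<bar>v x\<bar> * indicator {a<..<b} x)"
      by (intro L2_mult_integrable L2_abs v indicator_interval_L2)
    show "(\<lambda>x. v x * indicator {a<..<b} x) \<in> borel_measurable lborel"
      using L2_measurable[OF v] by measurable
    show "(\<lambda>x. v x * cutoff a b (real n) x) \<in> borel_measurable lborel" for n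
      using L2_measurable[OF v] L2_measurable[OF C1c_L2[OF cutoff_C1c[of "real n" a b]]] by simp
    show "AE x in lborel. (\<lambda>n. v x * cutoff a b (real n) x) \<longlonglongrightarrow> v x * indicator {a<..<b} x"
      by (intro AE_I2 tendsto_mult_left cutoff_tendsto)
    show "AE x in lborel. norm (v x * cutoff a b (real n) x) \<le> \<bar>v x\<bar> * indicator {a<..<b} x" for n
      by (intro AE_I2) (auto simp: abs_mult intro!: mult_left_mono cutoff_bound)
  qed
  moreover have "(LINT x|lborel. v x * cutoff a b (real n) x) = 0" for n
    by (intro z cutoff_C1c) simp
  ultimately show ?thesis by (simp add: LIMSEQ_const_iff)
qed

lemma integral_interval_zero_AE:
  fixes v :: "real \<Rightarrow> real"
  assumes v: "v \<in> L2"
    and z: "\<And>a b. (LINT x|lborel. v x * indicator {a<..<b} x) = 0"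
  shows "AE x in lborel. v x = 0"
proof -
  have "AE x in lborel. x \<in> {-real n<..<real n} \<longrightarrow> v x = 0" for n
  proof -
    define w where "w x = v x * indicator {-real n<..<real n} x" for x
    have w: "integrable lborel w"
      unfolding w_def by (intro L2_mult_integrable v indicator_interval_L2)
    have wm [measurable]: "w \<in> borel_measurable borel"
      using borel_measurable_integrable[OF w] by simp
    define P where "P x = max 0 (w x)" for x
    define Q where "Q x = max 0 (- w x)" for x
    have P: "integrable lborel P" unfolding P_def using w by (intro integrable_max) auto
    have Q: "integrable lborel Q" unfolding Q_def using w by (intro integrable_max) auto
    have [measurable]: "P \<in> borel_measurable borel" "Q \<in> borel_measurable borel"
      unfolding P_def Q_def by measurable
    have PQ: "w x = P x - Q x" for x by (simp add: P_def Q_def)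
    have em: "emeasure (density lborel (\<lambda>x. ennreal (F x))) A
        = ennreal (LINT x|lborel. F x * indicator A x)"
      if F: "integrable lborel F" "\<And>x. 0 \<le> F x" and A: "A \<in> sets borel" for F and A :: "real set"
    proof -
      have "emeasure (density lborel (\<lambda>x. ennreal (F x))) A
          = (\<integral>\<^sup>+x. ennreal (F x) * indicator A x \<partial>lborel)"
        using A borel_measurable_integrable[OF F(1)] by (subst emeasure_density) auto
      also have "\<dots> = (\<integral>\<^sup>+x. ennreal (F x * indicator A x) \<partial>lborel)"
        by (intro nn_integral_cong) (auto simp: indicator_def)
      also have "\<dots> = ennreal (LINT x|lborel. F x * indicator A x)"
        using F A by (intro nn_integral_eq_integral integrable_real_mult_indicator) auto
      finally show ?thesis .
    qed
    have eqi: "(LINT x|lborel. P x * indicator {c<..} x) = (LINT x|lborel. Q x * indicator {c<..} x)" for c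
    proof -
      have "0 = (LINT x|lborel. v x * indicator {max c (- real n)<..<real n} x)"
        using z by simp
      also have "\<dots> = (LINT x|lborel. P x * indicator {c<..} x - Q x * indicator {c<..} x)"
        by (intro Bochner_Integration.integral_cong refl)
          (auto simp: left_diff_distrib[symmetric] PQ[symmetric] w_def indicator_def)
      also have "\<dots> = (LINT x|lborel. P x * indicator {c<..} x) - (LINT x|lborel. Q x * indicator {c<..} x)"
        using P Q by (intro Bochner_Integration.integral_diff integrable_real_mult_indicator) auto
      finally show ?thesis by simp
    qed
    have "density lborel (\<lambda>x. ennreal (P x)) = density lborel (\<lambda>x. ennreal (Q x))"
    proof (rule measure_eqI_lessThan)
      fix c :: real
      show "emeasure (density lborel (\<lambda>x. ennreal (P x))) {c<..} < \<infinity>"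
        by (subst em[OF P]) (auto simp: P_def)
      show "emeasure (density lborel (\<lambda>x. ennreal (P x))) {c<..}
          = emeasure (density lborel (\<lambda>x. ennreal (Q x))) {c<..}"
        by (subst em[OF P], simp add: P_def, simp, subst em[OF Q], simp add: Q_def, simp, simp add: eqi)
    qed auto
    hence "AE x in lborel. ennreal (P x) = ennreal (Q x)"
      by (subst (asm) sigma_finite_measure.density_unique_iff[OF lborel.sigma_finite_measure_axioms]) auto
    thus ?thesis
    proof (rule AE_mp, intro AE_I2 impI)
      fix x assume "ennreal (P x) = ennreal (Q x)" and "x \<in> {-real n<..<real n}"
      hence "P x = Q x" and "w x = v x" by (auto simp: P_def Q_def w_def)
      thus "v x = 0" by (simp add: PQ)
    qed
  qed
  hence "AE x in lborel. \<forall>n. x \<in> {-real n<..<real n} \<longrightarrow> v x = 0"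
    by (subst AE_all_countable) blast
  thus ?thesis
  proof (rule AE_mp, intro AE_I2 impI)
    fix x :: real assume *: "\<forall>n. x \<in> {-real n<..<real n} \<longrightarrow> v x = 0"
    obtain n where "\<bar>x\<bar> < real n" using reals_Archimedean2 by blast
    thus "v x = 0" using * by (auto simp: abs_less_iff)
  qed
qed

lemma weak_deriv_unique:
  assumes "v \<in> L2" "w \<in> L2" "is_weak_deriv u v" "is_weak_deriv u w"
  shows "AE x in lborel. v x = w x"
proof -
  have w: "(\<lambda>x. (-1) * w x) \<in> L2" by (rule L2_scale[OF assms(2)])
  have "AE x in lborel. v x + (-1) * w x = 0"
  proof (rule integral_interval_zero_AE, rule L2_add[OF assms(1) w], rule integral_interval_zero)
    show "(\<lambda>x. v x + (-1) * w x) \<in> L2" by (rule L2_add[OF assms(1) w])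
    fix \<phi> assume p: "\<phi> \<in> C1c"
    have "(LINT x|lborel. v x * \<phi> x) = (LINT x|lborel. w x * \<phi> x)"
      using assms p by (simp add: is_weak_deriv_def)
    thus "(LINT x|lborel. (v x + (-1) * w x) * \<phi> x) = 0"
      using assms p by (simp add: ring_distribs L2_mult_integrable C1c_L2)
  qed
  thus ?thesis by auto
qed

lemma weak_deriv_eqI:
  assumes "u \<in> L2" "v \<in> L2" "is_weak_deriv u v"
  shows "AE x in lborel. weak_deriv u x = v x"
proof -
  have "u \<in> H1_funs" using assms by (auto simp: H1_funs_def)
  thus ?thesis using weak_deriv assms weak_deriv_unique by blast
qed

lemma weak_deriv_cong_AE:
  assumes "u \<in> H1_funs" "v \<in> H1_funs" "AE x in lborel. u x = v x"
  shows "AE x in lborel. weak_deriv u x = weak_deriv v x"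
proof -
  have "is_weak_deriv v (weak_deriv u)"
    by (rule is_weak_deriv_cong_AE[OF _ _ assms(3)])
      (use assms weak_deriv in \<open>auto simp: H1_funs_def\<close>)
  hence "AE x in lborel. weak_deriv v x = weak_deriv u x"
    using assms by (intro weak_deriv_eqI) (auto simp: weak_deriv H1_funs_L2)
  thus ?thesis by auto
qed

lemma H1_funs_zero: "(\<lambda>_. 0) \<in> H1_funs"
  using L2_zero is_weak_deriv_zero by (auto simp: H1_funs_def)

lemma H1_funs_add: "u \<in> H1_funs \<Longrightarrow> v \<in> H1_funs \<Longrightarrow> (\<lambda>x. u x + v x) \<in> H1_funs"
  unfolding H1_funs_def using L2_add is_weak_deriv_add by blast

lemma H1_funs_scale: "u \<in> H1_funs \<Longrightarrow> (\<lambda>x. c * u x) \<in> H1_funs"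
  unfolding H1_funs_def using L2_scale is_weak_deriv_scale by blast

lemma weak_deriv_add:
  assumes "u \<in> H1_funs" "v \<in> H1_funs"
  shows "AE x in lborel. weak_deriv (\<lambda>x. u x + v x) x = weak_deriv u x + weak_deriv v x"
  using assms by (intro weak_deriv_eqI is_weak_deriv_add L2_add) (auto simp: weak_deriv H1_funs_L2)

lemma weak_deriv_scale:
  assumes "u \<in> H1_funs"
  shows "AE x in lborel. weak_deriv (\<lambda>x. c * u x) x = c * weak_deriv u x"
  using assms by (intro weak_deriv_eqI is_weak_deriv_scale L2_scale) (auto simp: weak_deriv H1_funs_L2)


subsection \<open>The inner product space of almost-everywhere classes\<close>

definition H1_rel :: "(real \<Rightarrow> real) \<Rightarrow> (real \<Rightarrow> real) \<Rightarrow> bool" where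
  "H1_rel u v \<longleftrightarrow> u \<in> H1_funs \<and> v \<in> H1_funs \<and> (AE x in lborel. u x = v x)"

quotient_type H1 = "real \<Rightarrow> real" / partial: H1_rel
proof (rule part_equivpI)
  show "\<exists>u. H1_rel u u" using H1_funs_zero by (auto simp: H1_rel_def)
  show "symp H1_rel" by (auto simp: symp_def H1_rel_def elim: eventually_mono)
  show "transp H1_rel" by (auto simp: transp_def H1_rel_def elim: eventually_elim2)
qed

definition H1_ip :: "(real \<Rightarrow> real) \<Rightarrow> (real \<Rightarrow> real) \<Rightarrow> real" where
  "H1_ip u v = (LINT x|lborel. u x * v x) + (LINT x|lborel. weak_deriv u x * weak_deriv v x)"

lemma L2_ip_cong:
  assumes "u \<in> L2" "u' \<in> L2" "v \<in> L2" "v' \<in> L2"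
    "AE x in lborel. u x = u' x" "AE x in lborel. v x = v' x"
  shows "(LINT x|lborel. u x * v x) = (LINT x|lborel. u' x * v' x)"
proof (rule integral_cong_AE)
  show "(\<lambda>x. u x * v x) \<in> borel_measurable lborel" "(\<lambda>x. u' x * v' x) \<in> borel_measurable lborel"
    using assms by (intro L2_mult_measurable; simp)+
  show "AE x in lborel. u x * v x = u' x * v' x"
    using assms(5,6) by auto
qed

lemma H1_ip_cong:
  assumes "H1_rel u u'" "H1_rel v v'"
  shows "H1_ip u v = H1_ip u' v'"
  using assms unfolding H1_ip_def H1_rel_def
  by (intro arg_cong2[where f = "(+)"] L2_ip_cong weak_deriv_cong_AE) (auto simp: weak_deriv H1_funs_L2)

lemma H1_ip_add:
  assumes "u \<in> H1_funs" "v \<in> H1_funs" "w \<in> H1_funs"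
  shows "H1_ip (\<lambda>x. u x + v x) w = H1_ip u w + H1_ip v w"
proof -
  have "(LINT x|lborel. weak_deriv (\<lambda>x. u x + v x) x * weak_deriv w x)
      = (LINT x|lborel. (weak_deriv u x + weak_deriv v x) * weak_deriv w x)"
    using assms by (intro L2_ip_cong weak_deriv_add L2_add weak_deriv H1_funs_add) auto
  thus ?thesis using assms
    by (simp add: H1_ip_def ring_distribs L2_mult_integrable H1_funs_L2 weak_deriv)
qed

lemma H1_ip_scale:
  assumes "u \<in> H1_funs" "w \<in> H1_funs"
  shows "H1_ip (\<lambda>x. c * u x) w = c * H1_ip u w"
proof -
  have "(LINT x|lborel. weak_deriv (\<lambda>x. c * u x) x * weak_deriv w x)
      = (LINT x|lborel. (c * weak_deriv u x) * weak_deriv w x)"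
    using assms by (intro L2_ip_cong weak_deriv_scale L2_scale weak_deriv H1_funs_scale) auto
  thus ?thesis using assms
    by (simp add: H1_ip_def ring_distribs mult.assoc)
qed

lemma H1_ip_commute: "H1_ip u v = H1_ip v u"
  by (simp add: H1_ip_def mult.commute)

lemma H1_ip_nonneg: "0 \<le> H1_ip u u"
  by (simp add: H1_ip_def)

lemma H1_ip_eq_0:
  assumes u: "u \<in> H1_funs"
  shows "H1_ip u u = 0 \<longleftrightarrow> H1_rel u (\<lambda>_. 0)"
proof
  assume *: "H1_ip u u = 0"
  have "0 \<le> (LINT x|lborel. (u x)\<^sup>2)" "0 \<le> (LINT x|lborel. (weak_deriv u x)\<^sup>2)" by auto
  hence "(LINT x|lborel. (u x)\<^sup>2) = 0"
    using * unfolding H1_ip_def power2_eq_square by linarith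
  thus "H1_rel u (\<lambda>_. 0)"
    using u by (simp add: H1_rel_def H1_funs_zero L2_sq_zero_AE H1_funs_L2)
next
  assume *: "H1_rel u (\<lambda>_. 0)"
  have "H1_ip u u = H1_ip (\<lambda>x. 0 * u x) u"
    using H1_ip_cong[OF *, of u u] u by (simp add: H1_rel_def)
  thus "H1_ip u u = 0" using H1_ip_scale[OF u u, of 0] by simp
qed

instantiation H1 :: real_inner
begin

lift_definition zero_H1 :: H1 is "\<lambda>_. 0"
  by (simp add: H1_rel_def H1_funs_zero)

lift_definition plus_H1 :: "H1 \<Rightarrow> H1 \<Rightarrow> H1" is "\<lambda>u v x. u x + v x"
  by (auto simp: H1_rel_def H1_funs_add elim: eventually_elim2)

lift_definition scaleR_H1 :: "real \<Rightarrow> H1 \<Rightarrow> H1" is "\<lambda>c u x. c * u x"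
  by (auto simp: H1_rel_def H1_funs_scale elim: eventually_mono)

definition uminus_H1 :: "H1 \<Rightarrow> H1" where "uminus_H1 u = (-1) *\<^sub>R u"

definition minus_H1 :: "H1 \<Rightarrow> H1 \<Rightarrow> H1" where "minus_H1 u v = u + (- v)"

lift_definition inner_H1 :: "H1 \<Rightarrow> H1 \<Rightarrow> real" is H1_ip
  by (rule H1_ip_cong)

definition norm_H1 :: "H1 \<Rightarrow> real" where "norm_H1 u = sqrt (inner u u)"

definition dist_H1 :: "H1 \<Rightarrow> H1 \<Rightarrow> real" where "dist_H1 u v = norm (u - v)"

definition sgn_H1 :: "H1 \<Rightarrow> H1" where "sgn_H1 u = scaleR (inverse (norm u)) u"

definition uniformity_H1 :: "(H1 \<times> H1) filter" where
  "uniformity_H1 = (INF e\<in>{0<..}. principal {(x, y). dist x y < e})"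

definition open_H1 :: "H1 set \<Rightarrow> bool" where
  "open_H1 U \<longleftrightarrow> (\<forall>x\<in>U. \<forall>\<^sub>F (x', y) in uniformity. x' = x \<longrightarrow> y \<in> U)"

instance
proof
  fix u v w :: H1 and a b :: real
  show "u + v + w = u + (v + w)"
    by transfer (auto simp: H1_rel_def H1_funs_add add.assoc)
  show "u + v = v + u"
    by transfer (auto simp: H1_rel_def H1_funs_add add.commute)
  show "0 + u = u"
    by transfer (auto simp: H1_rel_def)
  show "- u + u = 0"
    unfolding uminus_H1_def
    by transfer (auto simp: H1_rel_def H1_funs_zero)
  show "u - v = u + - v" by (rule minus_H1_def)
  show "a *\<^sub>R (u + v) = a *\<^sub>R u + a *\<^sub>R v"
    by transfer (auto simp: H1_rel_def distrib_left intro!: H1_funs_add H1_funs_scale)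
  show "(a + b) *\<^sub>R u = a *\<^sub>R u + b *\<^sub>R u"
    by transfer (auto simp: H1_rel_def distrib_right intro!: H1_funs_add H1_funs_scale)
  show "a *\<^sub>R b *\<^sub>R u = (a * b) *\<^sub>R u"
    by transfer (auto simp: H1_rel_def mult.assoc[symmetric] intro!: H1_funs_scale)
  show "1 *\<^sub>R u = u"
    by transfer (auto simp: H1_rel_def)
  show "dist u v = norm (u - v)" by (rule dist_H1_def)
  show "sgn u = scaleR (inverse (norm u)) u" by (rule sgn_H1_def)
  show "(uniformity :: (H1 \<times> H1) filter) = (INF e\<in>{0<..}. principal {(x, y). dist x y < e})"
    by (rule uniformity_H1_def)
  show "open U \<longleftrightarrow> (\<forall>x\<in>U. \<forall>\<^sub>F (x', y) in uniformity. x' = x \<longrightarrow> y \<in> U)" for U :: "H1 set"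
    by (rule open_H1_def)
  show "inner u v = inner v u"
    by transfer (rule H1_ip_commute)
  show "inner (u + v) w = inner u w + inner v w"
    by transfer (auto simp: H1_rel_def H1_ip_add)
  show "inner (a *\<^sub>R u) v = a * inner u v"
    by transfer (auto simp: H1_rel_def H1_ip_scale)
  show "0 \<le> inner u u"
    by transfer (rule H1_ip_nonneg)
  show "inner u u = 0 \<longleftrightarrow> u = 0"
    by transfer (auto simp: H1_rel_def H1_ip_eq_0)
  show "norm u = sqrt (inner u u)" by (rule norm_H1_def)
qed

end

definition H1_fun :: "H1 \<Rightarrow> real \<Rightarrow> real" where
  "H1_fun u = rep_H1 u"

definition H1_deriv :: "H1 \<Rightarrow> real \<Rightarrow> real" where
  "H1_deriv u = weak_deriv (H1_fun u)"

lemma H1_fun_in: "H1_fun u \<in> H1_funs"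
  using Quotient3_rep_reflp[OF Quotient3_H1, of u] by (simp add: H1_fun_def H1_rel_def)

lemma H1_deriv_weak: "H1_deriv u \<in> L2" "is_weak_deriv (H1_fun u) (H1_deriv u)"
  using weak_deriv[OF H1_fun_in] by (auto simp: H1_deriv_def)

lemma H1_eq_iff: "u = v \<longleftrightarrow> (AE x in lborel. H1_fun u x = H1_fun v x)"
  using Quotient3_rel_rep[OF Quotient3_H1, of u v] H1_fun_in[of u] H1_fun_in[of v]
  by (simp add: H1_fun_def H1_rel_def)

lemma H1_norm_eq:
  "norm u = sqrt ((LINT x|lborel. (H1_fun u x)\<^sup>2) + (LINT x|lborel. (H1_deriv u x)\<^sup>2))"
proof -
  have "inner u u = H1_ip (H1_fun u) (H1_fun u)"
    by (simp add: inner_H1.rep_eq H1_fun_def)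
  thus ?thesis
    by (simp add: norm_eq_sqrt_inner H1_ip_def H1_deriv_def power2_eq_square)
qed


section \<open>The stationary equation\<close>

definition ext0 :: "(real \<Rightarrow> real) \<Rightarrow> real \<Rightarrow> real" where
  "ext0 g s = (if s \<le> 0 then 0 else g s)"

text \<open>Weak solutions of $-u'' + \lambda u = g(u)$, with \<open>g\<close> extended by zero. Elements of $H^1$ are
  essentially bounded, so for continuous \<open>g\<close> with \<open>g 0 = 0\<close> the right-hand integrand is
  automatically integrable.\<close>

definition weak_solution :: "(real \<Rightarrow> real) \<Rightarrow> real \<Rightarrow> H1 \<Rightarrow> bool" where
  "weak_solution g lam u \<longleftrightarrow>
     (\<forall>\<phi>\<in>C1c. (LINT x|lborel. H1_deriv u x * deriv \<phi> x) + lam * (LINT x|lborel. H1_fun u x * \<phi> x)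
        = (LINT x|lborel. ext0 g (H1_fun u x) * \<phi> x))"

definition H1_even :: "H1 \<Rightarrow> bool" where
  "H1_even u \<longleftrightarrow> (AE x in lborel. H1_fun u (- x) = H1_fun u x)"

end

theory Submission
  imports Defs
begin

text \<open>Multiplying the equation by $u'$ gives the energy identity $u'^2 = \lambda u^2 - 2 G(u)$, where $G' = g$.
  A critical point of \<open>u\<close> other than 0 would, by reflection, make \<open>u\<close> periodic, so the even solution is
  positive and strictly decreasing on the positive axis. Hence \<open>u 0\<close> is the first positive zero of
  $\lambda s^2 - 2 G(s)$, and this zero is transversal: otherwise \<open>u 0\<close> would be an equilibrium. A transversal
  first zero depends continuously on $\lambda$. Gronwall's inequality turns continuity of the initial values
  into pointwise convergence of \<open>u\<close> and \<open>u'\<close>, and since $G(s) = o(s^2)$ at 0 the energy identity yields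
  exponential decay, locally uniformly in $\lambda$; dominated convergence then gives convergence in $H^1$.\<close>

section \<open>Even homoclinic solutions of the autonomous equation\<close>

text \<open>The delicate point is the continuity of \<open>u 0\<close> in the parameter. The
  function \<open>lam * s\<^sup>2 - 2 * G s\<close> vanishes at \<open>s = 0\<close> for every
  \<open>lam\<close>; transversality keeps its first positive zero from jumping up, but says nothing
  about a drop towards 0. Monotonicity handles this: \<open>u 0\<close> increases strictly with
  \<open>lam\<close>, so its value at a smaller parameter is a floor, and above the floor the
  quotient \<open>2 * G s / s\<^sup>2\<close> can be maximized over a compact interval. The ODE
  arguments need twice differentiable functions, whereas an element of \<open>H1\<close> is an
  almost-everywhere class whose derivative is defined by testing. The bridge is the du Bois-Reymond
  lemma, used for \<open>u\<close>, then for its weak derivative, then again for \<open>u\<close>.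
  The exponent \<alpha> > 2 gives \<open>g' 0 = 0\<close>. This makes the extension of
  \<open>g\<close> by zero continuously differentiable on the whole line, hence locally Lipschitz,
  and yields G(s) = o(s^2).\<close>

text \<open>The function \<open>exp (- L * t) * (p t + e / L)\<close> is nonincreasing; the shift by
  \<open>e / L\<close> absorbs the constant term of the inequality.\<close>

lemma gronwall_affine:
  fixes p p' :: "real \<Rightarrow> real"
  assumes x: "0 \<le> x" and L: "0 < L"
    and d: "\<And>t. 0 \<le> t \<Longrightarrow> t \<le> x \<Longrightarrow> (p has_real_derivative p' t) (at t)"
    and le: "\<And>t. 0 \<le> t \<Longrightarrow> t \<le> x \<Longrightarrow> p' t \<le> L * p t + e"
  shows "p x \<le> (p 0 + e / L) * exp (L * x) - e / L"
proof -
  let ?q = "\<lambda>t. exp (- L * t) * (p t + e / L)"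
  have "?q x \<le> ?q 0"
  proof (rule DERIV_nonpos_imp_nonincreasing[OF x])
    fix t assume t: "0 \<le> t" "t \<le> x"
    have "(?q has_real_derivative exp (- L * t) * (p' t - L * p t - e)) (at t)"
      using L by (auto intro!: derivative_eq_intros d t simp: field_simps)
    moreover have "exp (- L * t) * (p' t - L * p t - e) \<le> 0"
      using le[OF t] by (simp add: mult_le_0_iff)
    ultimately show "\<exists>y. (?q has_real_derivative y) (at t) \<and> y \<le> 0" by blast
  qed
  hence "exp (L * x) * ?q x \<le> exp (L * x) * (p 0 + e / L)"
    by (intro mult_left_mono) auto
  moreover have "exp (L * x) * exp (- L * x) = 1"
    by (simp add: exp_minus)
  hence "exp (L * x) * ?q x = p x + e / L"
    by (simp only: mult.assoc[symmetric] mult_1_left)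
  ultimately have "p x + e / L \<le> exp (L * x) * (p 0 + e / L)" by linarith
  thus ?thesis by (simp add: mult.commute)
qed

text \<open>Here \<open>f\<close> stands for \<open>ext0 g\<close> and \<open>F\<close> for its
  primitive. Working on the whole line allows uniqueness and energy arguments before any sign of the
  solution is known.\<close>

locale scalar_field =
  fixes f f' F :: "real \<Rightarrow> real"
  assumes f_deriv: "\<And>s. (f has_real_derivative f' s) (at s)"
    and f'_cont: "continuous_on UNIV f'"
    and f'_0: "f' 0 = 0"
    and f_nonpos: "\<And>s. s \<le> 0 \<Longrightarrow> f s = 0"
    and f_pos: "\<And>s. 0 < s \<Longrightarrow> 0 < f s"
    and F_deriv: "\<And>s. (F has_real_derivative f s) (at s)"
    and F_0: "F 0 = 0"
begin

section \<open>Initial value problem: stability, uniqueness and energy\<close>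

definition solution :: "real \<Rightarrow> (real \<Rightarrow> real) \<Rightarrow> (real \<Rightarrow> real) \<Rightarrow> bool" where
  "solution lam w w' \<longleftrightarrow>
     (\<forall>x. (w has_real_derivative w' x) (at x)) \<and>
     (\<forall>x. (w' has_real_derivative lam * w x - f (w x)) (at x))"

lemma solutionD:
  assumes "solution lam w w'"
  shows "(w has_real_derivative w' x) (at x)"
    "(w' has_real_derivative lam * w x - f (w x)) (at x)"
    "continuous_on A w" "continuous_on A w'"
  using assms unfolding solution_def
  by (auto intro!: DERIV_continuous_on[OF has_field_derivative_at_within])

lemma f_lipschitz:
  obtains K where "0 \<le> K" "\<And>a b. \<bar>a\<bar> \<le> M \<Longrightarrow> \<bar>b\<bar> \<le> M \<Longrightarrow> \<bar>f a - f b\<bar> \<le> K * \<bar>a - b\<bar>"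
proof -
  have "compact (f' ` {-M..M})"
    by (intro compact_continuous_image continuous_on_subset[OF f'_cont]) auto
  hence "bounded (f' ` {-M..M})" by (rule compact_imp_bounded)
  then obtain K where K: "0 < K" "\<forall>v\<in>f' ` {-M..M}. norm v \<le> K"
    unfolding bounded_pos by blast
  have "norm (f a - f b) \<le> K * norm (a - b)" if "\<bar>a\<bar> \<le> M" "\<bar>b\<bar> \<le> M" for a b
    by (rule field_differentiable_bound[of "{-M..M}" f f'])
      (use K that in \<open>auto intro: has_field_derivative_at_within[OF f_deriv]\<close>)
  thus thesis using that[of K] K(1) by auto
qed

lemma F_nonpos: "s \<le> 0 \<Longrightarrow> F s = 0"
proof -
  assume s: "s \<le> 0"
  have "F s = F 0"
  proof (cases "s = 0")
    case False
    hence "s < 0" using s by simp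
    then obtain z where "s < z" "z < 0" "F 0 - F s = (0 - s) * f z"
      using MVT2[of s 0 F f] F_deriv by blast
    thus ?thesis using f_nonpos[of z] by simp
  qed simp
  thus "F s = 0" using F_0 by simp
qed

lemma F_nonneg: "0 \<le> s \<Longrightarrow> 0 \<le> F s"
proof (cases "s = 0")
  case False
  assume "0 \<le> s"
  hence "0 < s" using False by simp
  then obtain z where "0 < z" "z < s" "F s - F 0 = (s - 0) * f z"
    using MVT2[of 0 s F f] F_deriv by blast
  thus ?thesis using f_pos[of z] F_0 by simp
qed (simp add: F_0)

text \<open>Two applications of the mean value theorem give \<open>F s = s * z * f' y\<close> with
  \<open>0 < y < z < s\<close>, and \<open>f'\<close> is small near 0.\<close>

lemma F_small:
  assumes e: "0 < e"
  obtains \<delta> where "0 < \<delta>" "\<And>s. 0 \<le> s \<Longrightarrow> s \<le> \<delta> \<Longrightarrow> F s \<le> e * s\<^sup>2"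
proof -
  have "isCont f' 0" using f'_cont by (simp add: continuous_on_eq_continuous_at)
  then obtain d where d: "0 < d" "\<And>s. dist s 0 < d \<Longrightarrow> dist (f' s) (f' 0) < e"
    unfolding continuous_at_eps_delta using e by blast
  have "F s \<le> e * s\<^sup>2" if s: "0 \<le> s" "s \<le> d / 2" for s
  proof (cases "s = 0")
    case False
    hence "0 < s" using s by simp
    then obtain z where z: "0 < z" "z < s" "F s - F 0 = (s - 0) * f z"
      using MVT2[of 0 s F f] F_deriv by blast
    then obtain y where y: "0 < y" "y < z" "f z - f 0 = (z - 0) * f' y"
      using MVT2[of 0 z f f'] f_deriv by blast
    have "f' y \<le> e" using d(2)[of y] y z s f'_0 by (auto simp: dist_real_def)
    hence "z * f' y \<le> s * e" using y z e f_pos[of z] f_nonpos[of 0]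
      by (intro mult_mono) (auto simp: zero_less_mult_iff)
    hence "f z \<le> s * e" using y f_nonpos[of 0] by simp
    hence "s * f z \<le> s * (s * e)" using s by (intro mult_left_mono)
    thus ?thesis using z F_0 by (simp add: power2_eq_square mult_ac)
  qed (simp add: F_0)
  thus thesis using that[of "d / 2"] d(1) by simp
qed

text \<open>The squared phase-space distance of two trajectories obeys an affine differential
  inequality. The parameters may differ: their difference enters only the constant term
  \<open>e\<close>, while \<open>L\<close> does not depend on \<open>lam2\<close>, so the bound is
  usable as \<open>lam2\<close> tends to \<open>lam\<close>.\<close>

lemma solution_stability:
  assumes 1: "solution lam w w'" and 2: "solution lam2 u u'"
    and K: "0 \<le> K" "\<And>a b. \<bar>a\<bar> \<le> M \<Longrightarrow> \<bar>b\<bar> \<le> M \<Longrightarrow> \<bar>f a - f b\<bar> \<le> K * \<bar>a - b\<bar>"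
    and b: "\<And>t. 0 \<le> t \<Longrightarrow> t \<le> x \<Longrightarrow> \<bar>w t\<bar> \<le> M" "\<And>t. 0 \<le> t \<Longrightarrow> t \<le> x \<Longrightarrow> \<bar>u t\<bar> \<le> M"
    and x: "0 \<le> x"
  defines "L \<equiv> 2 + \<bar>lam\<bar> + K" and "e \<equiv> ((lam2 - lam) * M)\<^sup>2"
  shows "(w x - u x)\<^sup>2 + (w' x - u' x)\<^sup>2
    \<le> ((w 0 - u 0)\<^sup>2 + (w' 0 - u' 0)\<^sup>2 + e / L) * exp (L * x) - e / L"
proof (rule gronwall_affine[OF x, where p' = "\<lambda>t. 2 * (w t - u t) * (w' t - u' t)
      + 2 * (w' t - u' t) * (lam * w t - f (w t) - (lam2 * u t - f (u t)))"])
  show "0 < L" using K by (simp add: L_def)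
next
  fix t assume t: "0 \<le> t" "t \<le> x"
  show "((\<lambda>x. (w x - u x)\<^sup>2 + (w' x - u' x)\<^sup>2) has_real_derivative 2 * (w t - u t) * (w' t - u' t)
      + 2 * (w' t - u' t) * (lam * w t - f (w t) - (lam2 * u t - f (u t)))) (at t)"
    by (auto intro!: derivative_eq_intros solutionD[OF 1] solutionD[OF 2] simp: algebra_simps)
  define d d' r where "d = w t - u t" and "d' = w' t - u' t"
    and "r = lam * w t - f (w t) - (lam2 * u t - f (u t))"
  have am: "2 * a * b \<le> a\<^sup>2 + b\<^sup>2" for a b :: real by (rule sum_squares_bound)
  \<comment> \<open>This splitting separates the effect of different states, which is Lipschitz in
    \<open>d\<close>, from the effect of different parameters.\<close>
  have "r = lam * d - (lam2 - lam) * u t - (f (w t) - f (u t))"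
    by (simp add: r_def d_def algebra_simps)
  moreover have "\<bar>f (w t) - f (u t)\<bar> \<le> K * \<bar>d\<bar>" unfolding d_def by (intro K b t)
  moreover have "\<bar>lam * d\<bar> = \<bar>lam\<bar> * \<bar>d\<bar>" by (rule abs_mult)
  moreover have "(\<bar>lam\<bar> + K) * \<bar>d\<bar> = \<bar>lam\<bar> * \<bar>d\<bar> + K * \<bar>d\<bar>" by (rule distrib_right)
  moreover have "\<bar>(lam2 - lam) * u t\<bar> \<le> \<bar>(lam2 - lam) * M\<bar>"
    using b(2)[OF t] by (auto simp: abs_mult intro!: mult_left_mono)
  ultimately have r: "\<bar>r\<bar> \<le> (\<bar>lam\<bar> + K) * \<bar>d\<bar> + \<bar>(lam2 - lam) * M\<bar>"
    by linarith
  have "2 * d' * r \<le> 2 * \<bar>d'\<bar> * \<bar>r\<bar>" by (metis abs_ge_self abs_mult abs_numeral)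
  also have "\<dots> \<le> 2 * \<bar>d'\<bar> * ((\<bar>lam\<bar> + K) * \<bar>d\<bar> + \<bar>(lam2 - lam) * M\<bar>)"
    using r by (intro mult_left_mono) auto
  also have "\<dots> = (\<bar>lam\<bar> + K) * (2 * \<bar>d'\<bar> * \<bar>d\<bar>) + 2 * \<bar>d'\<bar> * \<bar>(lam2 - lam) * M\<bar>"
    by (simp add: algebra_simps)
  also have "\<dots> \<le> (\<bar>lam\<bar> + K) * (\<bar>d'\<bar>\<^sup>2 + \<bar>d\<bar>\<^sup>2) + (\<bar>d'\<bar>\<^sup>2 + \<bar>(lam2 - lam) * M\<bar>\<^sup>2)"
    using K(1) by (intro add_mono mult_left_mono am) auto
  finally have A: "2 * d' * r \<le> (\<bar>lam\<bar> + K) * (d'\<^sup>2 + d\<^sup>2) + (d'\<^sup>2 + e)" by (simp add: e_def)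
  have B: "2 * d * d' \<le> d\<^sup>2 + d'\<^sup>2" by (rule am)
  have C: "0 \<le> d\<^sup>2" by simp
  \<comment> \<open>The 2 in \<open>L\<close> consists of 1 from \<open>B\<close> and 1 from the
    extra \<open>d'\<^sup>2\<close> in \<open>A\<close>; \<open>C\<close> supplies the
    \<open>d\<^sup>2\<close> to match it.\<close>
  have "2 * d * d' + 2 * d' * r \<le> L * (d\<^sup>2 + d'\<^sup>2) + e"
    unfolding L_def using A B C unfolding distrib_left distrib_right by linarith
  thus "2 * (w t - u t) * (w' t - u' t) + 2 * (w' t - u' t) * (lam * w t - f (w t) - (lam2 * u t - f (u t)))
      \<le> L * ((w t - u t)\<^sup>2 + (w' t - u' t)\<^sup>2) + e"
    by (simp add: d_def d'_def r_def)
qed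

lemma solution_shift:
  assumes "solution lam w w'" shows "solution lam (\<lambda>x. w (a + x)) (\<lambda>x. w' (a + x))"
proof -
  have s: "((\<lambda>x. a + x) has_real_derivative 1) (at x)" for x :: real
    by (auto intro!: derivative_eq_intros)
  show ?thesis unfolding solution_def
    using DERIV_chain2[OF solutionD(1)[OF assms] s] DERIV_chain2[OF solutionD(2)[OF assms] s] by simp
qed

lemma solution_reflect:
  assumes "solution lam w w'" shows "solution lam (\<lambda>x. w (a - x)) (\<lambda>x. - w' (a - x))"
proof -
  have s: "((\<lambda>x. a - x) has_real_derivative -1) (at x)" for x :: real
    by (auto intro!: derivative_eq_intros)
  show ?thesis unfolding solution_def
    using DERIV_chain2[OF solutionD(1)[OF assms] s]
      DERIV_minus[OF DERIV_chain2[OF solutionD(2)[OF assms] s]] by simp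
qed

lemma solution_const: "f c = lam * c \<Longrightarrow> solution lam (\<lambda>_. c) (\<lambda>_. 0)"
  by (simp add: solution_def)

text \<open>With equal parameters and equal initial data the stability bound is 0; compactness of
  \<open>{0..x}\<close> provides the common bound \<open>M\<close>.\<close>

lemma solution_unique_right:
  assumes 1: "solution lam w w'" and 2: "solution lam u u'" and "w 0 = u 0" "w' 0 = u' 0" and x: "0 \<le> x"
  shows "w x = u x"
proof -
  have "bounded ((\<lambda>t. \<bar>w t\<bar> + \<bar>u t\<bar>) ` {0..x})"
    by (intro compact_imp_bounded compact_continuous_image continuous_intros
        solutionD(3)[OF 1] solutionD(3)[OF 2]) auto
  then obtain M where "\<forall>v\<in>(\<lambda>t. \<bar>w t\<bar> + \<bar>u t\<bar>) ` {0..x}. \<bar>v\<bar> \<le> M"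
    unfolding bounded_real by blast
  hence M: "\<bar>\<bar>w t\<bar> + \<bar>u t\<bar>\<bar> \<le> M" if "t \<in> {0..x}" for t using that by blast
  have M': "\<bar>w t\<bar> \<le> M" "\<bar>u t\<bar> \<le> M" if "0 \<le> t" "t \<le> x" for t using M[of t] that by auto
  obtain K where K: "0 \<le> K" "\<And>a b. \<bar>a\<bar> \<le> M \<Longrightarrow> \<bar>b\<bar> \<le> M \<Longrightarrow> \<bar>f a - f b\<bar> \<le> K * \<bar>a - b\<bar>"
    using f_lipschitz[of M] by blast
  have "(w x - u x)\<^sup>2 + (w' x - u' x)\<^sup>2 \<le> 0"
    using solution_stability[OF 1 2 K M' x] assms(3,4) by simp
  thus ?thesis by (simp add: sum_power2_le_zero_iff)
qed

text \<open>Shifting to \<open>a\<close>, or reflecting about \<open>a\<close>, reduces either side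
  of \<open>a\<close> to forward uniqueness from 0.\<close>

lemma solution_unique:
  assumes 1: "solution lam w w'" and 2: "solution lam u u'" and "w a = u a" "w' a = u' a"
  shows "w = u"
proof
  fix x
  show "w x = u x"
  proof (cases "a \<le> x")
    case True
    thus ?thesis
      using solution_unique_right[OF solution_shift[OF 1, of a] solution_shift[OF 2, of a], of "x - a"] assms
      by simp
  next
    case False
    thus ?thesis
      using solution_unique_right[OF solution_reflect[OF 1, of a] solution_reflect[OF 2, of a], of "a - x"] assms
      by simp
  qed
qed

lemma energy_constant:
  assumes "solution lam w w'"
  shows "(w' x)\<^sup>2 - lam * (w x)\<^sup>2 + 2 * F (w x) = (w' y)\<^sup>2 - lam * (w y)\<^sup>2 + 2 * F (w y)"
proof -
  have "((\<lambda>x. (w' x)\<^sup>2 - lam * (w x)\<^sup>2 + 2 * F (w x)) has_real_derivative 0) (at x)" for x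
    by (auto intro!: derivative_eq_intros solutionD[OF assms] DERIV_chain2[OF F_deriv]
        simp: algebra_simps)
  thus ?thesis using DERIV_isconst_all by blast
qed

text \<open>The clause on $w'^2$ is the energy identity at level zero, stated here because for weak
  solutions it comes from square integrability of the derivative.\<close>

definition ground_state :: "real \<Rightarrow> (real \<Rightarrow> real) \<Rightarrow> (real \<Rightarrow> real) \<Rightarrow> bool" where
  "ground_state lam w w' \<longleftrightarrow> 0 < lam \<and> solution lam w w' \<and> (\<forall>x. w (- x) = w x) \<and>
     (w \<longlongrightarrow> 0) at_top \<and> (\<forall>x. (w' x)\<^sup>2 = lam * (w x)\<^sup>2 - 2 * F (w x)) \<and> (\<exists>x. w x \<noteq> 0)"

section \<open>Shape of a single ground state\<close>

context
  fixes lam w w'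
  assumes gs: "ground_state lam w w'"
begin

lemma gs_lam: "0 < lam" and gs_sol: "solution lam w w'" and gs_even: "w (- x) = w x"
  and gs_lim: "(w \<longlongrightarrow> 0) at_top" and gs_energy: "(w' x)\<^sup>2 = lam * (w x)\<^sup>2 - 2 * F (w x)"
  using gs by (auto simp: ground_state_def)

lemma gs_deriv_odd: "w' (- x) = - w' x"
proof -
  have "solution lam w (\<lambda>x. - w' (- x))"
    using solution_reflect[OF gs_sol, of 0] by (simp add: gs_even)
  from DERIV_unique[OF solutionD(1)[OF this, of x] solutionD(1)[OF gs_sol, of x]] show ?thesis by simp
qed

lemma gs_deriv_0: "w' 0 = 0"
  using gs_deriv_odd[of 0] by simp

text \<open>At a zero of \<open>w\<close> the energy identity forces \<open>w' = 0\<close> as well,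
  and uniqueness identifies \<open>w\<close> with the equilibrium 0.\<close>

lemma gs_nonzero: "w x \<noteq> 0"
proof
  assume x: "w x = 0"
  hence "w' x = 0" using gs_energy[of x] F_0 by simp
  hence "w = (\<lambda>_. 0)"
    using solution_unique[OF gs_sol solution_const[of 0 lam], of x] x f_nonpos[of 0] by simp
  thus False using gs by (simp add: ground_state_def)
qed

text \<open>Having no zeros, \<open>w\<close> keeps one sign. It is positive at 0: if
  \<open>w 0 \<le> 0\<close>, then \<open>F (w 0) = 0\<close>, and the energy identity at the
  critical point 0 gives \<open>w 0 = 0\<close>.\<close>

lemma gs_pos: "0 < w x"
proof (rule ccontr)
  assume "\<not> 0 < w x"
  hence x: "w x < 0" using gs_nonzero[of x] by simp
  have 0: "0 < w 0"
  proof (rule ccontr)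
    assume "\<not> 0 < w 0"
    hence "lam * (w 0)\<^sup>2 = 0" using gs_energy[of 0] F_nonpos[of "w 0"] gs_deriv_0 by simp
    thus False using gs_lam gs_nonzero by simp
  qed
  have "connected (w ` UNIV)"
    by (intro connected_continuous_image solutionD(3)[OF gs_sol] connected_UNIV)
  hence "0 \<in> w ` UNIV"
    using connectedD_interval[of "range w" "w x" "w 0" 0] x 0 by auto
  thus False using gs_nonzero by auto
qed

lemma gs_deriv_nonzero:
  assumes x: "0 < x" shows "w' x \<noteq> 0"
proof
  assume 0: "w' x = 0"
  have "(\<lambda>t. w (x + t)) = (\<lambda>t. w (x - t))"
    by (rule solution_unique[OF solution_shift[OF gs_sol, of x] solution_reflect[OF gs_sol, of x], of 0])
      (simp_all add: 0)
  hence refl: "w (x + t) = w (x - t)" for t by (rule fun_cong)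
  \<comment> \<open>Reflection about \<open>x\<close> composed with reflection about 0 is
    translation by \<open>2 * x\<close>.\<close>
  have per: "w (t + 2 * x) = w t" for t
    using refl[of "x + t"] gs_even[of t] by (simp add: algebra_simps)
  have "w (real n * (2 * x)) = w 0" for n
  proof (induction n)
    case (Suc n)
    thus ?case using per[of "real n * (2 * x)"] by (simp add: algebra_simps)
  qed simp
  moreover have "filterlim (\<lambda>n. real n * (2 * x)) at_top sequentially"
    using x by (intro filterlim_at_top_mult_tendsto_pos[OF tendsto_const] filterlim_real_sequentially) auto
  hence "(\<lambda>n. w (real n * (2 * x))) \<longlonglongrightarrow> 0"
    by (rule filterlim_compose[OF gs_lim])
  ultimately have "w 0 = 0" by (simp add: LIMSEQ_const_iff)
  thus False using gs_nonzero by simp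
qed

text \<open>On the positive axis \<open>w'\<close> has no zero, hence one sign. If it were positive,
  \<open>w\<close> would stay above \<open>w 0 > 0\<close> and could not tend to 0.\<close>

lemma gs_deriv_neg:
  assumes x: "0 < x" shows "w' x < 0"
proof (rule ccontr)
  assume "\<not> w' x < 0"
  hence px: "0 < w' x" using gs_deriv_nonzero[OF x] by simp
  have pos: "0 < w' y" if y: "0 < y" for y
  proof (rule ccontr)
    assume "\<not> 0 < w' y"
    hence "w' y < 0" using gs_deriv_nonzero[OF y] by simp
    moreover have "connected (w' ` {0<..})"
      by (intro connected_continuous_image solutionD(4)[OF gs_sol] connected_Ioi)
    ultimately have "0 \<in> w' ` {0<..}"
      using connectedD_interval[of "w' ` {0<..}" "w' y" "w' x" 0] px x y by auto
    thus False using gs_deriv_nonzero by auto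
  qed
  have "w 0 \<le> w y" if "0 \<le> y" for y
  proof (rule DERIV_nonneg_imp_nondecreasing[OF that])
    fix z :: real assume "0 \<le> z"
    hence "0 \<le> w' z" using pos[of z] gs_deriv_0 by (cases "z = 0") auto
    thus "\<exists>d. (w has_real_derivative d) (at z) \<and> 0 \<le> d" using solutionD(1)[OF gs_sol] by blast
  qed
  hence "\<forall>\<^sub>F y in at_top. w 0 \<le> w y" by (intro eventually_at_top_linorderI[of 0])
  hence "w 0 \<le> 0" using tendsto_lowerbound[OF gs_lim] by simp
  thus False using gs_pos[of 0] by simp
qed

lemma gs_decreasing:
  assumes "0 \<le> x" "x \<le> y" shows "w y \<le> w x"
proof (rule DERIV_nonpos_imp_nonincreasing[OF assms(2)])
  fix z assume "x \<le> z" "z \<le> y"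
  hence "w' z \<le> 0" using assms(1) gs_deriv_neg[of z] gs_deriv_0 by (cases "z = 0") auto
  thus "\<exists>d. (w has_real_derivative d) (at z) \<and> d \<le> 0" using solutionD(1)[OF gs_sol] by blast
qed

lemma gs_le_0: "w x \<le> w 0"
  using gs_decreasing[of 0 x] gs_decreasing[of 0 "- x"] gs_even[of x] by (cases "0 \<le> x") auto

lemma gs_top_zero: "lam * (w 0)\<^sup>2 = 2 * F (w 0)"
  using gs_energy[of 0] gs_deriv_0 by simp

text \<open>Each level \<open>s\<close> is attained at some \<open>x > 0\<close>, where
  \<open>w' x \<noteq> 0\<close> makes the energy identity strict. Together with
  \<open>gs_top_zero\<close> this makes \<open>w 0\<close> the first positive zero of
  \<open>lam * s\<^sup>2 - 2 * F s\<close>.\<close>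

lemma gs_below_top:
  assumes s: "0 < s" "s < w 0" shows "2 * F s < lam * s\<^sup>2"
proof -
  have "\<forall>\<^sub>F y in at_top. w y < s \<and> 0 \<le> y"
    by (intro eventually_conj order_tendstoD(2)[OF gs_lim s(1)] eventually_ge_at_top)
  then obtain y where y: "w y < s" "0 \<le> y"
    using eventually_happens trivial_limit_at_top_linorder by blast
  then obtain x where x: "0 \<le> x" "x \<le> y" "w x = s"
    using IVT2'[of w y s 0] s solutionD(3)[OF gs_sol] by auto
  hence "x \<noteq> 0" using s by auto
  hence "0 < (w' x)\<^sup>2" using gs_deriv_nonzero[of x] x by simp
  thus ?thesis using gs_energy[of x] x by simp
qed

lemma gs_top_transversal: "lam * w 0 < f (w 0)"
proof (rule ccontr)
  assume n: "\<not> lam * w 0 < f (w 0)"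
  show False
  proof (cases "f (w 0) = lam * w 0")
    case True
    hence "w = (\<lambda>_. w 0)"
      using solution_unique[OF gs_sol solution_const, of "w 0" 0] gs_deriv_0 by simp
    hence "((\<lambda>_::real. w 0) \<longlongrightarrow> 0) at_top" using gs_lim by simp
    thus False using gs_nonzero[of 0] by (simp add: tendsto_const_iff)
  next
    case False
    \<comment> \<open>The second derivative of \<open>w\<close> at 0 is positive here, so
      \<open>w'\<close> would be positive just to the right of 0, against
      \<open>gs_deriv_neg\<close>.\<close>
    then obtain d where "0 < d" "\<And>h. 0 < h \<Longrightarrow> h < d \<Longrightarrow> w' 0 < w' (0 + h)"
      using DERIV_pos_inc_right[OF solutionD(2)[OF gs_sol, of 0]] n by auto
    from this(2)[of "d / 2"] this(1) show False
      using gs_deriv_0 gs_deriv_neg[of "d / 2"] by simp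
  qed
qed

lemma gs_deriv_le: "\<bar>w' x\<bar> \<le> sqrt lam * w x"
proof -
  have "(w' x)\<^sup>2 \<le> lam * (w x)\<^sup>2"
    using gs_energy[of x] F_nonneg[of "w x"] gs_pos[of x] by simp
  hence "sqrt ((w' x)\<^sup>2) \<le> sqrt (lam * (w x)\<^sup>2)" by (rule real_sqrt_le_mono)
  thus ?thesis using gs_pos[of x] by (simp add: real_sqrt_mult)
qed

text \<open>Where \<open>w \<le> \<delta>\<close>, the energy identity gives \<open>w'\<^sup>2 \<ge>
  (lam - 2 * e) * w\<^sup>2 \<ge> (c * w)\<^sup>2\<close>, so \<open>exp (c * t) * w t\<close> is
  nonincreasing beyond \<open>R\<close>. Up to \<open>R\<close> the bound is just
  \<open>w \<le> w 0\<close>, at the price of the factor \<open>exp (c * R)\<close>.\<close>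

lemma gs_decay:
  assumes c: "0 < c" "c\<^sup>2 + 2 * e \<le> lam" and F: "\<And>s. 0 \<le> s \<Longrightarrow> s \<le> \<delta> \<Longrightarrow> F s \<le> e * s\<^sup>2"
    and R: "0 \<le> R" "w R \<le> \<delta>"
  shows "w x \<le> w 0 * exp (c * R) * exp (- (c * \<bar>x\<bar>))"
proof -
  have dec: "w y \<le> w 0 * exp (c * R) * exp (- (c * y))" if y: "0 \<le> y" for y
  proof (cases "y \<le> R")
    case True
    have "w y * 1 \<le> w 0 * exp (c * (R - y))"
      using True c gs_le_0[of y] gs_pos[of 0] by (intro mult_mono) auto
    moreover have "exp (c * (R - y)) = exp (c * R) * exp (- (c * y))"
      by (simp add: exp_add[symmetric] right_diff_distrib)
    ultimately show ?thesis by (simp add: mult.assoc)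
  next
    case False
    let ?q = "\<lambda>t. exp (c * t) * w t"
    have "?q y \<le> ?q R"
    proof (rule DERIV_nonpos_imp_nonincreasing[where f = ?q])
      show "R \<le> y" using False by simp
      fix t assume t: "R \<le> t" "t \<le> y"
      have wt: "w t \<le> \<delta>" using gs_decreasing[OF R(1) t(1)] R(2) by simp
      have "(c * w t)\<^sup>2 + 2 * e * (w t)\<^sup>2 \<le> lam * (w t)\<^sup>2"
        using mult_right_mono[OF c(2), of "(w t)\<^sup>2"] by (simp add: algebra_simps power_mult_distrib)
      hence "(c * w t)\<^sup>2 \<le> (- w' t)\<^sup>2"
        using F[of "w t"] gs_pos[of t] wt gs_energy[of t] by simp
      moreover have "0 \<le> - w' t"
        using gs_deriv_neg[of t] gs_deriv_0 R(1) t(1) by (cases "t = 0") auto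
      ultimately have "c * w t \<le> - w' t" by (rule power2_le_imp_le)
      hence "exp (c * t) * (c * w t + w' t) \<le> 0" by (simp add: mult_le_0_iff)
      moreover have "(?q has_real_derivative exp (c * t) * (c * w t + w' t)) (at t)"
        by (auto intro!: derivative_eq_intros solutionD(1)[OF gs_sol] simp: algebra_simps)
      ultimately show "\<exists>d. (?q has_real_derivative d) (at t) \<and> d \<le> 0" by blast
    qed
    also have "\<dots> \<le> exp (c * R) * w 0" using gs_le_0 by simp
    finally have "exp (- (c * y)) * ?q y \<le> exp (- (c * y)) * (exp (c * R) * w 0)"
      by (intro mult_left_mono) auto
    moreover have "exp (- (c * y)) * exp (c * y) = 1"
      by (simp add: exp_minus)
    hence "exp (- (c * y)) * ?q y = w y"
      by (simp only: mult.assoc[symmetric] mult_1_left)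
    ultimately show ?thesis by (simp only: mult_ac)
  qed
  show ?thesis using dec[of "\<bar>x\<bar>"] gs_even[of x] by (cases "0 \<le> x") auto
qed

end

text \<open>Since \<open>w 0\<close> is the first positive zero for \<open>lam\<close>,
  \<open>u 0 \<le> w 0\<close> would give
  \<open>lam2 * (u 0)\<^sup>2 = 2 * F (u 0) \<le> lam * (u 0)\<^sup>2\<close>.\<close>

lemma gs_top_mono:
  assumes 1: "ground_state lam w w'" and 2: "ground_state lam2 u u'" and less: "lam < lam2"
  shows "w 0 < u 0"
proof (rule ccontr)
  assume "\<not> w 0 < u 0"
  hence "2 * F (u 0) \<le> lam * (u 0)\<^sup>2"
    using gs_below_top[OF 1, of "u 0"] gs_top_zero[OF 1] gs_pos[OF 2, of 0] by (cases "u 0 = w 0") auto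
  hence "lam2 * (u 0)\<^sup>2 \<le> lam * (u 0)\<^sup>2" using gs_top_zero[OF 2] by simp
  thus False using less gs_pos[OF 2, of 0] by simp
qed

section \<open>Dependence of the ground state on the parameter\<close>

context
  fixes W W' :: "real \<Rightarrow> real \<Rightarrow> real"
  assumes gs: "\<And>lam. 0 < lam \<Longrightarrow> ground_state lam (W lam) (W' lam)"
begin

lemma eventually_gs: "0 < a \<Longrightarrow> \<forall>\<^sub>F lam in at a. ground_state lam (W lam) (W' lam)"
  using order_tendstoD(1)[OF tendsto_ident_at, of 0 a UNIV] by (auto elim: eventually_mono intro: gs)

lemma gs_top_tendsto:
  assumes a: "0 < a"
  shows "((\<lambda>lam. W lam 0) \<longlongrightarrow> W a 0) (at a)"
proof (rule order_tendstoI)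
  fix y assume y: "W a 0 < y"
  let ?z = "W a 0"
  have "((\<lambda>s. a * s\<^sup>2 - 2 * F s) has_real_derivative 2 * (a * ?z - f ?z)) (at ?z)"
    by (auto intro!: derivative_eq_intros F_deriv simp: algebra_simps)
  moreover have "2 * (a * ?z - f ?z) < 0" using gs_top_transversal[OF gs[OF a]] by simp
  ultimately obtain d where d: "0 < d"
    "\<And>h. 0 < h \<Longrightarrow> h < d \<Longrightarrow> a * (?z + h)\<^sup>2 - 2 * F (?z + h) < a * ?z\<^sup>2 - 2 * F ?z"
    using DERIV_neg_dec_right[of "\<lambda>s. a * s\<^sup>2 - 2 * F s"] by blast
  \<comment> \<open>A point between \<open>W a 0\<close> and \<open>y\<close> within the range of
    \<open>d\<close>, so that \<open>a * s\<^sup>2 - 2 * F s < 0\<close>. The inequality persists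
    for \<open>lam\<close> near \<open>a\<close>, and by \<open>gs_below_top\<close> it prevents
    \<open>s < W lam 0\<close>.\<close>
  define s where "s = ?z + min (d / 2) ((y - ?z) / 2)"
  have s: "?z < s" "s < y" using d(1) y by (auto simp: s_def min_def field_simps)
  have neg: "a * s\<^sup>2 - 2 * F s < 0"
    using d(2)[of "min (d / 2) ((y - ?z) / 2)"] d(1) y gs_top_zero[OF gs[OF a]]
    unfolding s_def by (simp add: min_def split: if_splits)
  have "((\<lambda>lam. lam * s\<^sup>2 - 2 * F s) \<longlongrightarrow> a * s\<^sup>2 - 2 * F s) (at a)"
    by (intro tendsto_intros)
  hence "\<forall>\<^sub>F lam in at a. lam * s\<^sup>2 - 2 * F s < 0" using neg by (rule order_tendstoD(2))
  thus "\<forall>\<^sub>F lam in at a. W lam 0 < y"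
    using eventually_gs[OF a]
  proof eventually_elim
    case (elim lam)
    thus ?case
      using gs_below_top[OF elim(2), of s] s gs_pos[OF gs[OF a], of 0] by (cases "s < W lam 0") auto
  qed
next
  fix y assume y: "y < W a 0"
  \<comment> \<open>The value at parameter \<open>a / 2\<close> is the floor: by
    \<open>gs_top_mono\<close> it lies below \<open>W lam 0\<close> for every
    \<open>lam > a / 2\<close>.\<close>
  let ?b = "W (a / 2) 0"
  have b: "0 < ?b" "?b < W a 0"
    using gs_pos[OF gs, of "a / 2" 0] gs_top_mono[OF gs gs, of "a / 2" a] a by auto
  define h where "h s = 2 * F s / s\<^sup>2" for s
  define y' where "y' = max ?b y"
  have y': "?b \<le> y'" "y' < W a 0" using y b by (auto simp: y'_def)
  have "continuous_on {?b..y'} h" unfolding h_def using b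
    by (intro continuous_intros DERIV_continuous_on[OF has_field_derivative_at_within[OF F_deriv]]) auto
  then obtain m where m: "m \<in> {?b..y'}" "\<And>s. s \<in> {?b..y'} \<Longrightarrow> h s \<le> h m"
    using continuous_attains_sup[of "{?b..y'}" h] y' by auto
  \<comment> \<open>Since \<open>h (W lam 0) = lam\<close>, a parameter \<open>lam > h m\<close>
    keeps \<open>W lam 0\<close> out of \<open>{?b..y'}\<close>; being above the floor, it is then
    above \<open>y'\<close>.\<close>
  have "h m < a"
    using gs_below_top[OF gs[OF a], of m] m(1) b y' by (simp add: h_def divide_simps)
  hence "\<forall>\<^sub>F lam in at a. h m < lam"
    by (intro order_tendstoD(1)[OF tendsto_ident_at])
  moreover have "\<forall>\<^sub>F lam in at a. a / 2 < lam"
    using a by (intro order_tendstoD(1)[OF tendsto_ident_at]) auto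
  ultimately show "\<forall>\<^sub>F lam in at a. y < W lam 0"
    using eventually_gs[OF a]
  proof eventually_elim
    case (elim lam)
    have "?b < W lam 0" using gs_top_mono[OF gs elim(3), of "a / 2"] elim a by simp
    moreover have "h (W lam 0) = lam"
      using gs_top_zero[OF elim(3)] gs_pos[OF elim(3), of 0] by (simp add: h_def divide_simps)
    hence "W lam 0 \<notin> {?b..y'}" using m(2)[of "W lam 0"] elim(1) by auto
    ultimately show ?case by (auto simp: y'_def)
  qed
qed

text \<open>Both derivatives vanish at 0, so the initial data differ only by
  \<open>W a 0 - W lam 0\<close>, and the Gronwall bound \<open>B lam\<close> tends to 0.\<close>

lemma gs_tendsto_right:
  assumes a: "0 < a" and x: "0 \<le> x"
  shows "((\<lambda>lam. (W a x - W lam x)\<^sup>2 + (W' a x - W' lam x)\<^sup>2) \<longlongrightarrow> 0) (at a)"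
proof -
  \<comment> \<open>Ground states are positive with maximum at 0, so \<open>M\<close> bounds
    \<open>W a\<close> and, once \<open>W lam 0\<close> is close to \<open>W a 0\<close>, also
    \<open>W lam\<close>.\<close>
  define M where "M = W a 0 + 1"
  obtain K where K: "0 \<le> K" "\<And>a b. \<bar>a\<bar> \<le> M \<Longrightarrow> \<bar>b\<bar> \<le> M \<Longrightarrow> \<bar>f a - f b\<bar> \<le> K * \<bar>a - b\<bar>"
    using f_lipschitz[of M] by blast
  define L where "L = 2 + \<bar>a\<bar> + K"
  have L: "0 < L" using K(1) by (simp add: L_def)
  define B where "B lam = ((W a 0 - W lam 0)\<^sup>2 + ((lam - a) * M)\<^sup>2 / L) * exp (L * x) - ((lam - a) * M)\<^sup>2 / L"
    for lam
  have "(B \<longlongrightarrow> ((W a 0 - W a 0)\<^sup>2 + ((a - a) * M)\<^sup>2 / L) * exp (L * x) - ((a - a) * M)\<^sup>2 / L) (at a)"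
    unfolding B_def using L by (intro tendsto_intros gs_top_tendsto a) auto
  hence B: "(B \<longlongrightarrow> 0) (at a)" by simp
  have "\<forall>\<^sub>F lam in at a. W lam 0 < M"
    by (rule order_tendstoD(2)[OF gs_top_tendsto[OF a]]) (simp add: M_def)
  hence "\<forall>\<^sub>F lam in at a. (W a x - W lam x)\<^sup>2 + (W' a x - W' lam x)\<^sup>2 \<le> B lam"
    using eventually_gs[OF a]
  proof eventually_elim
    case (elim lam)
    have bd: "\<bar>W lam t\<bar> \<le> M" "\<bar>W a t\<bar> \<le> M" for t
      using gs_le_0[OF elim(2), of t] gs_pos[OF elim(2), of t] elim(1)
        gs_le_0[OF gs[OF a], of t] gs_pos[OF gs[OF a], of t] by (auto simp: M_def)
    show ?case
      using solution_stability[OF gs_sol[OF gs[OF a]] gs_sol[OF elim(2)] K bd(2) bd(1) x]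
        gs_deriv_0[OF gs[OF a]] gs_deriv_0[OF elim(2)] by (simp add: B_def L_def)
  qed
  thus ?thesis
    by (intro tendsto_sandwich[OF _ _ tendsto_const B]) auto
qed

lemma gs_tendsto:
  assumes a: "0 < a"
  shows "((\<lambda>lam. W lam x) \<longlongrightarrow> W a x) (at a)" "((\<lambda>lam. W' lam x) \<longlongrightarrow> W' a x) (at a)"
proof -
  have "((\<lambda>lam. (W a x - W lam x)\<^sup>2 + (W' a x - W' lam x)\<^sup>2) \<longlongrightarrow> 0) (at a)"
  proof (cases "0 \<le> x")
    case False
    have "\<forall>\<^sub>F lam in at a. (W a (- x) - W lam (- x))\<^sup>2 + (W' a (- x) - W' lam (- x))\<^sup>2
        = (W a x - W lam x)\<^sup>2 + (W' a x - W' lam x)\<^sup>2"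
      using eventually_gs[OF a]
    proof eventually_elim
      case (elim lam)
      have "- W' a x + W' lam x = - (W' a x - W' lam x)" by simp
      thus ?case
        using gs_even[OF elim] gs_even[OF gs[OF a]] gs_deriv_odd[OF elim] gs_deriv_odd[OF gs[OF a]]
        by (simp add: power2_commute)
    qed
    from Lim_transform_eventually[OF gs_tendsto_right[OF a] this] False show ?thesis by simp
  qed (use gs_tendsto_right[OF a] in blast)
  hence lim: "((\<lambda>lam. sqrt ((W a x - W lam x)\<^sup>2 + (W' a x - W' lam x)\<^sup>2)) \<longlongrightarrow> 0) (at a)"
    using tendsto_real_sqrt by fastforce
  have "((\<lambda>lam. W lam x - W a x) \<longlongrightarrow> 0) (at a)"
    by (rule Lim_null_comparison[OF always_eventually lim])
      (auto intro: real_le_rsqrt simp: power2_commute[of "W a x"])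
  thus "((\<lambda>lam. W lam x) \<longlongrightarrow> W a x) (at a)" by (simp only: LIM_zero_iff)
  have "((\<lambda>lam. W' lam x - W' a x) \<longlongrightarrow> 0) (at a)"
    by (rule Lim_null_comparison[OF always_eventually lim])
      (auto intro: real_le_rsqrt simp: power2_commute[of "W' a x"])
  thus "((\<lambda>lam. W' lam x) \<longlongrightarrow> W' a x) (at a)" by (simp only: LIM_zero_iff)
qed

text \<open>The radius \<open>R\<close> is chosen for \<open>a\<close> alone. Convergence at the
  single point \<open>R\<close> keeps \<open>W lam R < \<delta>\<close> for nearby
  \<open>lam\<close>, which is all that \<open>gs_decay\<close> needs to give constants independent
  of \<open>lam\<close>.\<close>

lemma gs_uniform_decay:
  assumes a: "0 < a"
  obtains C c where "0 < c"
    "\<forall>\<^sub>F lam in at a. \<forall>x. \<bar>W lam x\<bar> \<le> C * exp (- (c * \<bar>x\<bar>)) \<and> \<bar>W' lam x\<bar> \<le> C * exp (- (c * \<bar>x\<bar>))"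
    "\<forall>x. \<bar>W a x\<bar> \<le> C * exp (- (c * \<bar>x\<bar>)) \<and> \<bar>W' a x\<bar> \<le> C * exp (- (c * \<bar>x\<bar>))"
proof -
  obtain \<delta> where \<delta>: "0 < \<delta>" "\<And>s. 0 \<le> s \<Longrightarrow> s \<le> \<delta> \<Longrightarrow> F s \<le> a / 8 * s\<^sup>2"
    using F_small[of "a / 8"] a by auto
  have "\<forall>\<^sub>F y in at_top. W a y < \<delta> \<and> 0 \<le> y"
    by (intro eventually_conj order_tendstoD(2)[OF gs_lim[OF gs[OF a]] \<delta>(1)] eventually_ge_at_top)
  then obtain R where R: "W a R < \<delta>" "0 \<le> R"
    using eventually_happens trivial_limit_at_top_linorder by blast
  \<comment> \<open>With \<open>e = a / 8\<close> this rate gives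
    \<open>c\<^sup>2 + 2 * e = a / 2\<close>, which is below every
    \<open>lam > a / 2\<close>.\<close>
  define c where "c = sqrt a / 2"
  define M where "M = W a 0 + 1"
  \<comment> \<open>The summand 1 serves \<open>W\<close>; \<open>sqrt (2 * a)\<close>, a bound for
    \<open>sqrt lam\<close>, serves \<open>W'\<close> through \<open>gs_deriv_le\<close>.\<close>
  define C where "C = (1 + sqrt (2 * a)) * (M * exp (c * R))"
  have c: "0 < c" using a by (simp add: c_def)
  have bound: "\<bar>W lam x\<bar> \<le> C * exp (- (c * \<bar>x\<bar>)) \<and> \<bar>W' lam x\<bar> \<le> C * exp (- (c * \<bar>x\<bar>))"
    if g: "ground_state lam (W lam) (W' lam)" and lam: "a / 2 < lam" "lam < 2 * a"
      and M: "W lam 0 < M" and WR: "W lam R < \<delta>" for lam x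
  proof -
    let ?E = "M * exp (c * R) * exp (- (c * \<bar>x\<bar>))"
    have "c\<^sup>2 + 2 * (a / 8) \<le> lam" using lam a by (simp add: c_def power_divide)
    hence "W lam x \<le> W lam 0 * exp (c * R) * exp (- (c * \<bar>x\<bar>))"
      using WR by (intro gs_decay[OF g c _ \<delta>(2) R(2)]) auto
    also have "\<dots> \<le> ?E" using M by (intro mult_right_mono) auto
    finally have 1: "\<bar>W lam x\<bar> \<le> ?E" using gs_pos[OF g, of x] by simp
    hence E: "0 \<le> ?E" by linarith
    have s0: "0 \<le> sqrt (2 * a)" using a by simp
    have "\<bar>W' lam x\<bar> \<le> sqrt lam * W lam x" by (rule gs_deriv_le[OF g])
    also have "\<dots> \<le> sqrt (2 * a) * ?E"
      using lam 1 gs_pos[OF g, of x] s0 by (intro mult_mono) auto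
    finally have 2: "\<bar>W' lam x\<bar> \<le> sqrt (2 * a) * ?E" .
    have CE: "C * exp (- (c * \<bar>x\<bar>)) = ?E + sqrt (2 * a) * ?E" by (simp add: C_def algebra_simps)
    show ?thesis using 1 2 E s0 mult_nonneg_nonneg[OF s0 E] unfolding CE by linarith
  qed
  have "\<forall>\<^sub>F lam in at a. a / 2 < lam" "\<forall>\<^sub>F lam in at a. lam < 2 * a"
    using order_tendstoD(1)[OF tendsto_ident_at[of a UNIV], of "a / 2"]
      order_tendstoD(2)[OF tendsto_ident_at[of a UNIV], of "2 * a"] a by auto
  moreover have "\<forall>\<^sub>F lam in at a. W lam 0 < M"
    by (rule order_tendstoD(2)[OF gs_top_tendsto[OF a]]) (simp add: M_def)
  moreover have "\<forall>\<^sub>F lam in at a. W lam R < \<delta>"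
    by (rule order_tendstoD(2)[OF gs_tendsto(1)[OF a] R(1)])
  ultimately have "\<forall>\<^sub>F lam in at a. \<forall>x. \<bar>W lam x\<bar> \<le> C * exp (- (c * \<bar>x\<bar>)) \<and> \<bar>W' lam x\<bar> \<le> C * exp (- (c * \<bar>x\<bar>))"
    using eventually_gs[OF a] by eventually_elim (use bound in blast)
  moreover have "\<forall>x. \<bar>W a x\<bar> \<le> C * exp (- (c * \<bar>x\<bar>)) \<and> \<bar>W' a x\<bar> \<le> C * exp (- (c * \<bar>x\<bar>))"
    using bound[OF gs[OF a]] a R by (auto simp: M_def)
  ultimately show thesis using that c by blast
qed

end

end


section \<open>Regularity of weak solutions\<close>

text \<open>The set where two continuous functions differ is open, and an open null set is
  empty.\<close>

lemma continuous_AE_eq_imp_eq: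
  fixes f g :: "real \<Rightarrow> real"
  assumes f: "continuous_on UNIV f" and g: "continuous_on UNIV g" and ae: "AE x in lborel. f x = g x"
  shows "f = g"
proof -
  let ?S = "{x. f x \<noteq> g x}"
  have "open ?S" using f g by (rule open_Collect_neq)
  moreover have "?S \<in> null_sets lborel"
    using ae \<open>open ?S\<close> by (subst AE_iff_null_sets) (auto intro!: borel_open)
  hence "negligible ?S"
    by (simp add: negligible_iff_null_sets null_sets_completionI)
  ultimately have "?S = {}" using open_not_negligible by blast
  thus ?thesis by auto
qed

lemma AE_reflect:
  assumes f: "f \<in> borel_measurable borel" and g: "g \<in> borel_measurable borel"
    and ae: "AE x::real in lborel. f x = (g x :: real)"
  shows "AE x in lborel. f (- x) = g (- x)"
proof -
  have "Measurable.pred borel (\<lambda>x. f x = g x)" using f g by measurable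
  from AE_borel_affine[OF _ this ae, of "-1" 0] show ?thesis by simp
qed

lemma integrable_continuous_compact_support:
  fixes f :: "real \<Rightarrow> real"
  assumes f: "continuous_on UNIV f" and z: "\<And>x. R \<le> \<bar>x\<bar> \<Longrightarrow> f x = 0"
  shows "integrable lborel f"
proof -
  have "integrable lborel (\<lambda>x. indicator {-R..R} x *\<^sub>R f x)"
    by (intro borel_integrable_compact continuous_on_subset[OF f]) auto
  moreover have "(\<lambda>x. indicator {-R..R} x *\<^sub>R f x) = f"
  proof
    fix x
    show "indicator {-R..R} x *\<^sub>R f x = f x"
      using z[of x] by (cases "R \<le> \<bar>x\<bar>") (auto simp: indicator_def)
  qed
  ultimately show ?thesis by simp
qed

lemma continuous_antiderivative:
  fixes f :: "real \<Rightarrow> real"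
  assumes "continuous_on UNIV f"
  obtains Q where "\<And>x. (Q has_real_derivative f x) (at x)"
proof -
  have "\<exists>F. \<forall>x::real. - \<infinity> < ereal x \<longrightarrow> ereal x < \<infinity> \<longrightarrow> (F has_vector_derivative f x) (at x)"
    using assms by (intro einterval_antiderivative) (auto simp: continuous_on_eq_continuous_at)
  thus thesis using that by (auto simp: has_real_derivative_iff_has_vector_derivative)
qed

section \<open>Calculus with test functions\<close>

lemma C1c_support:
  assumes "\<phi> \<in> C1c"
  obtains R where "0 < R" "\<And>x. R \<le> \<bar>x\<bar> \<Longrightarrow> \<phi> x = 0" "\<And>x. R \<le> \<bar>x\<bar> \<Longrightarrow> deriv \<phi> x = 0"
proof -
  have "bounded {x. \<phi> x \<noteq> 0}"
    using assms bounded_subset[OF compact_imp_bounded closure_subset] by (auto simp: C1c_def)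
  then obtain B where B: "0 < B" "\<And>x. \<phi> x \<noteq> 0 \<Longrightarrow> \<bar>x\<bar> \<le> B"
    unfolding bounded_pos by auto
  \<comment> \<open>One unit further out, \<open>x\<close> has a neighbourhood on which
    \<open>\<phi>\<close> vanishes, so the same radius serves for the derivative.\<close>
  have "deriv \<phi> x = 0" if x: "B + 1 \<le> \<bar>x\<bar>" for x
  proof -
    have "open {y::real. B < \<bar>y\<bar>}" by (intro open_Collect_less continuous_intros)
    hence "\<forall>\<^sub>F y in nhds x. y \<in> {y. B < \<bar>y\<bar>}"
      using x by (intro eventually_nhds_in_open) auto
    hence "\<forall>\<^sub>F y in nhds x. \<phi> y = 0"
      by (rule eventually_mono) (use B(2) in force)
    hence "deriv \<phi> x = deriv (\<lambda>_. 0) x" by (intro deriv_cong_ev) auto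
    thus ?thesis by simp
  qed
  moreover have "\<phi> x = 0" if "B + 1 \<le> \<bar>x\<bar>" for x using B(2)[of x] that by force
  ultimately show thesis using that[of "B + 1"] B(1) by simp
qed

lemma C1cI:
  fixes \<phi> :: "real \<Rightarrow> real"
  assumes D: "\<And>x. (\<phi> has_real_derivative D x) (at x)" and c: "continuous_on UNIV D"
    and z: "\<And>x. R \<le> \<bar>x\<bar> \<Longrightarrow> \<phi> x = 0"
  shows "\<phi> \<in> C1c" "deriv \<phi> = D"
proof -
  have "bounded {x. \<phi> x \<noteq> 0}"
    unfolding bounded_real using z by (intro exI[of _ R]) (force simp: not_le)
  hence "compact (closure {x. \<phi> x \<noteq> 0})" by (simp add: compact_eq_bounded_closed bounded_closure)
  moreover have "\<phi> C1_differentiable_on UNIV"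
    unfolding C1_differentiable_on_def using D c
    by (auto simp: has_real_derivative_iff_has_vector_derivative[symmetric])
  ultimately show "\<phi> \<in> C1c" by (simp add: C1c_def)
  show "deriv \<phi> = D" using D DERIV_imp_deriv by blast
qed

lemma C1c_deriv_integrable: "\<phi> \<in> C1c \<Longrightarrow> integrable lborel (deriv \<phi>)"
  by (rule C1c_support, assumption, rule integrable_continuous_compact_support, rule C1cD) auto

text \<open>Half-line integrals of \<open>deriv \<phi>\<close> are the inner integrals that Fubini's
  theorem produces in \<open>primitive_by_parts\<close>.\<close>

lemma C1c_integral_deriv_Ici:
  assumes \<phi>: "\<phi> \<in> C1c"
  shows "(LINT x|lborel. deriv \<phi> x * indicator {t..} x) = - \<phi> t"
proof -
  obtain R where R: "0 < R" "\<And>x. R \<le> \<bar>x\<bar> \<Longrightarrow> \<phi> x = 0" "\<And>x. R \<le> \<bar>x\<bar> \<Longrightarrow> deriv \<phi> x = 0"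
    using C1c_support[OF \<phi>] by blast
  let ?b = "max t R"
  have "(LINT x|lborel. deriv \<phi> x * indicator {t..} x) = (LINT x|lborel. deriv \<phi> x * indicator {t..?b} x)"
    using R(1) by (intro Bochner_Integration.integral_cong refl) (auto simp: indicator_def not_le R(3))
  also have "\<dots> = \<phi> ?b - \<phi> t"
    using C1cD[OF \<phi>] by (intro integral_FTC_Icc_real) (auto simp: continuous_on_eq_continuous_at)
  also have "\<phi> ?b = 0" using R(1) by (intro R(2)) auto
  finally show ?thesis by simp
qed

lemma C1c_integral_deriv:
  assumes \<phi>: "\<phi> \<in> C1c"
  shows "(LINT x|lborel. deriv \<phi> x) = 0"
proof -
  obtain R where R: "0 < R" "\<And>x. R \<le> \<bar>x\<bar> \<Longrightarrow> \<phi> x = 0" "\<And>x. R \<le> \<bar>x\<bar> \<Longrightarrow> deriv \<phi> x = 0"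
    using C1c_support[OF \<phi>] by blast
  have "(LINT x|lborel. deriv \<phi> x) = (LINT x|lborel. deriv \<phi> x * indicator {-R..} x)"
    using R(1) by (intro Bochner_Integration.integral_cong refl) (auto simp: indicator_def not_le R(3))
  thus ?thesis using C1c_integral_deriv_Ici[OF \<phi>, of "- R"] R by simp
qed

lemma C1c_integral_deriv_Iio:
  assumes \<phi>: "\<phi> \<in> C1c"
  shows "(LINT x|lborel. deriv \<phi> x * indicator {..<t} x) = \<phi> t"
proof -
  have "(LINT x|lborel. deriv \<phi> x * indicator {..<t} x)
      = (LINT x|lborel. deriv \<phi> x - deriv \<phi> x * indicator {t..} x)"
    by (intro Bochner_Integration.integral_cong refl) (auto simp: indicator_def)
  also have "\<dots> = \<phi> t"
    using C1c_deriv_integrable[OF \<phi>] C1c_integral_deriv[OF \<phi>] C1c_integral_deriv_Ici[OF \<phi>]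
    by (subst Bochner_Integration.integral_diff) (auto intro: integrable_real_mult_indicator)
  finally show ?thesis .
qed

text \<open>The product of \<open>Q\<close> and \<open>\<phi>\<close> is itself a test function, so
  the integral of its derivative vanishes.\<close>

lemma C1_integral_by_parts:
  fixes Q q :: "real \<Rightarrow> real"
  assumes Q: "\<And>x. (Q has_real_derivative q x) (at x)" and q: "continuous_on UNIV q" and \<phi>: "\<phi> \<in> C1c"
  shows "(LINT x|lborel. Q x * deriv \<phi> x) = - (LINT x|lborel. q x * \<phi> x)"
proof -
  obtain R where R: "0 < R" "\<And>x. R \<le> \<bar>x\<bar> \<Longrightarrow> \<phi> x = 0" "\<And>x. R \<le> \<bar>x\<bar> \<Longrightarrow> deriv \<phi> x = 0"
    using C1c_support[OF \<phi>] by blast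
  have cQ: "continuous_on UNIV Q" using DERIV_continuous_on[OF has_field_derivative_at_within[OF Q]] .
  have c\<phi>: "continuous_on UNIV \<phi>" using DERIV_continuous_on[OF has_field_derivative_at_within[OF C1cD(1)[OF \<phi>]]] .
  have 1: "((\<lambda>x. Q x * \<phi> x) has_real_derivative q x * \<phi> x + Q x * deriv \<phi> x) (at x)" for x
    by (auto intro!: derivative_eq_intros Q C1cD(1)[OF \<phi>])
  have 2: "continuous_on UNIV (\<lambda>x. q x * \<phi> x + Q x * deriv \<phi> x)"
    by (intro continuous_intros q c\<phi> cQ C1cD(2)[OF \<phi>])
  have 3: "R \<le> \<bar>x\<bar> \<Longrightarrow> Q x * \<phi> x = 0" for x using R by simp
  have "(LINT x|lborel. q x * \<phi> x + Q x * deriv \<phi> x) = 0"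
    using C1c_integral_deriv[OF C1cI(1)[OF 1 2 3]] C1cI(2)[OF 1 2 3] by simp
  moreover have "integrable lborel (\<lambda>x. q x * \<phi> x)" "integrable lborel (\<lambda>x. Q x * deriv \<phi> x)"
    by (auto intro!: integrable_continuous_compact_support[where R = R] continuous_intros
        q c\<phi> cQ C1cD(2)[OF \<phi>] simp: R)
  ultimately show ?thesis by simp
qed

text \<open>An antiderivative is constant on each side of the support; zero mean makes the two
  constants equal, and subtracting their value gives compact support.\<close>

lemma C1c_antiderivative:
  fixes \<eta> :: "real \<Rightarrow> real"
  assumes c: "continuous_on UNIV \<eta>" and z: "\<And>x. R \<le> \<bar>x\<bar> \<Longrightarrow> \<eta> x = 0" and R: "0 < R"
    and i: "(LINT x|lborel. \<eta> x) = 0"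
  obtains \<phi> where "\<phi> \<in> C1c" "deriv \<phi> = \<eta>"
proof -
  obtain A where A: "\<And>x. (A has_real_derivative \<eta> x) (at x)"
    using continuous_antiderivative[OF c] by blast
  have FTC: "(LINT x|lborel. \<eta> x * indicator {a..b} x) = A b - A a" if "a \<le> b" for a b
    using that A c by (intro integral_FTC_Icc_real) (auto simp: continuous_on_eq_continuous_at)
  have "(LINT x|lborel. \<eta> x) = (LINT x|lborel. \<eta> x * indicator {-R..R} x)"
    by (intro Bochner_Integration.integral_cong refl) (auto simp: indicator_def not_le intro!: z)
  hence AR: "A R = A (- R)" using FTC[of "- R" R] R i by simp
  have "A x - A R = 0" if x: "R \<le> \<bar>x\<bar>" for x
  proof (cases "0 \<le> x")
    case True
    have "(\<lambda>y. \<eta> y * indicator {R..x} y) = (\<lambda>_. 0)"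
      using R by (auto simp: indicator_def fun_eq_iff intro!: z)
    thus ?thesis using FTC[of R x] x True by simp
  next
    case False
    have "(\<lambda>y. \<eta> y * indicator {x..-R} y) = (\<lambda>_. 0)"
      using R by (auto simp: indicator_def fun_eq_iff intro!: z)
    thus ?thesis using FTC[of x "-R"] x False AR by simp
  qed
  moreover have "((\<lambda>x. A x - A R) has_real_derivative \<eta> x) (at x)" for x
    by (auto intro!: derivative_eq_intros A)
  ultimately show thesis using that C1cI[of "\<lambda>x. A x - A R" \<eta> R] c by blast
qed

section \<open>The du Bois-Reymond lemma\<close>

lemma L2_mult_indicator_integrable:
  "u \<in> L2 \<Longrightarrow> integrable lborel (\<lambda>x. u x * indicator {a<..<b} x)"
  by (intro L2_mult_integrable indicator_interval_L2)

text \<open>By hypothesis \<open>f - P\<close> annihilates derivatives of test functions, that is,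
  continuous compactly supported functions of mean zero, so against cutoffs it acts like a constant.
  \<open>P\<close> is merely continuous because it will be a primitive, which need not be square
  integrable.\<close>

lemma du_Bois_Reymond:
  assumes f: "f \<in> L2" and P: "continuous_on UNIV P"
    and eq: "\<And>\<phi>. \<phi> \<in> C1c \<Longrightarrow> (LINT x|lborel. f x * deriv \<phi> x) = (LINT x|lborel. P x * deriv \<phi> x)"
  obtains c where "AE x in lborel. f x = P x + c"
proof -
  have C: "continuous_on UNIV (cutoff a b n)" if "0 \<le> n" for a b n
    using DERIV_continuous_on[OF has_field_derivative_at_within[OF C1cD(1)[OF cutoff_C1c[OF that]]]] .
  have Z: "cutoff a b n x = 0" if "0 \<le> n" "\<bar>a\<bar> + \<bar>b\<bar> + 1 \<le> \<bar>x\<bar>" for a b n x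
  proof -
    have "x \<notin> {a<..<b}" using that(2) by auto
    thus ?thesis using cutoff_bound[OF that(1), of a b x] by simp
  qed
  define \<rho> where "\<rho> = cutoff 0 1 1"
  define I where "I = (LINT x|lborel. \<rho> x)"
  have \<rho>: "continuous_on UNIV \<rho>" "\<And>x. 2 \<le> \<bar>x\<bar> \<Longrightarrow> \<rho> x = 0" "\<rho> \<in> L2"
    using C[of 1 0 1] Z[of 1 0 1] C1c_L2[OF cutoff_C1c[of 1 0 1]] by (auto simp: \<rho>_def)
  have i\<rho>: "integrable lborel \<rho>" by (rule integrable_continuous_compact_support[OF \<rho>(1,2)])
  have "I \<noteq> 0"
  proof
    assume "I = 0"
    moreover have "0 \<le> \<rho> x" for x by (simp add: \<rho>_def cutoff_def bump_nonneg)
    ultimately have "AE x in lborel. \<rho> x = 0"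
      using integral_nonneg_eq_0_iff_AE[OF i\<rho>] by (simp add: I_def)
    hence "\<rho> = (\<lambda>_. 0)" by (intro continuous_AE_eq_imp_eq \<rho>) auto
    hence "\<rho> (1 / 2) = 0" by simp
    moreover have "0 < \<rho> (1 / 2)"
      using bump_pos_iff[of 0 1 "1 / 2"] by (simp add: \<rho>_def cutoff_def add_pos_pos)
    ultimately show False by simp
  qed
  have iP: "integrable lborel (\<lambda>x. P x * \<psi> x)"
    if "continuous_on UNIV \<psi>" "\<And>x. R \<le> \<bar>x\<bar> \<Longrightarrow> \<psi> x = 0" for \<psi> R
    by (rule integrable_continuous_compact_support[where R = R]) (auto intro!: continuous_intros P that simp: that)
  have mP: "P \<in> borel_measurable borel" using P by (rule borel_measurable_continuous_onI)
  have mf: "f \<in> borel_measurable borel" by (rule L2_measurable[OF f])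
  txt \<open>Subtracting a multiple of the fixed bump \<open>\<rho>\<close> makes any cutoff function \<open>\<psi>\<close> the derivative of a test
    function.\<close>
  define c where "c = ((LINT x|lborel. f x * \<rho> x) - (LINT x|lborel. P x * \<rho> x)) / I"
  have test: "(LINT x|lborel. (f x - P x - c) * cutoff a b (real n) x) = 0" for a b n
  proof -
    define \<psi> where "\<psi> = cutoff a b (real n)"
    define r where "r = \<bar>a\<bar> + \<bar>b\<bar> + 1"
    have \<psi>: "continuous_on UNIV \<psi>" "\<And>x. r \<le> \<bar>x\<bar> \<Longrightarrow> \<psi> x = 0" "\<psi> \<in> L2"
      using C[of "real n" a b] Z[of "real n" a b] C1c_L2[OF cutoff_C1c[of "real n" a b]]
      by (auto simp: \<psi>_def r_def)
    have i\<psi>: "integrable lborel \<psi>" by (rule integrable_continuous_compact_support[OF \<psi>(1,2)])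
    define k where "k = (LINT x|lborel. \<psi> x) / I"
    define \<eta> where "\<eta> x = \<psi> x - k * \<rho> x" for x
    have c\<eta>: "continuous_on UNIV \<eta>" unfolding \<eta>_def by (intro continuous_intros \<psi> \<rho>)
    have z\<eta>: "r + 2 \<le> \<bar>x\<bar> \<Longrightarrow> \<eta> x = 0" for x
      using \<psi>(2)[of x] \<rho>(2)[of x] by (simp add: \<eta>_def r_def)
    have "(LINT x|lborel. \<eta> x) = 0"
      using i\<psi> i\<rho> \<open>I \<noteq> 0\<close> by (simp add: \<eta>_def k_def I_def[symmetric])
    moreover have "0 < r + 2" by (simp add: r_def)
    ultimately obtain \<phi> where "\<phi> \<in> C1c" "deriv \<phi> = \<eta>"
      using C1c_antiderivative[OF c\<eta> z\<eta>] by blast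
    hence "(LINT x|lborel. f x * \<eta> x) = (LINT x|lborel. P x * \<eta> x)" using eq[of \<phi>] by simp
    hence "(LINT x|lborel. f x * \<psi> x - k * (f x * \<rho> x)) = (LINT x|lborel. P x * \<psi> x - k * (P x * \<rho> x))"
      by (simp add: \<eta>_def algebra_simps)
    moreover have int: "integrable lborel (\<lambda>x. f x * \<psi> x)" "integrable lborel (\<lambda>x. f x * \<rho> x)"
      "integrable lborel (\<lambda>x. P x * \<psi> x)" "integrable lborel (\<lambda>x. P x * \<rho> x)"
      using L2_mult_integrable[OF f \<psi>(3)] L2_mult_integrable[OF f \<rho>(3)] iP[OF \<psi>(1,2)] iP[OF \<rho>(1,2)] by auto
    ultimately have E: "(LINT x|lborel. f x * \<psi> x) - (LINT x|lborel. P x * \<psi> x)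
        = k * ((LINT x|lborel. f x * \<rho> x) - (LINT x|lborel. P x * \<rho> x))"
      by (simp add: algebra_simps)
    have "(LINT x|lborel. (f x - P x - c) * \<psi> x) = (LINT x|lborel. f x * \<psi> x - P x * \<psi> x - c * \<psi> x)"
      by (simp add: algebra_simps)
    also have "\<dots> = (LINT x|lborel. f x * \<psi> x) - (LINT x|lborel. P x * \<psi> x) - c * (LINT x|lborel. \<psi> x)"
      using int i\<psi> by simp
    also have "\<dots> = 0" unfolding E by (simp add: k_def c_def)
    finally show ?thesis by (simp add: \<psi>_def)
  qed
  \<comment> \<open>As \<open>P + c\<close> need not be in \<open>L2\<close>,
    \<open>integral_interval_zero_AE\<close> is applied to restrictions to bounded
    intervals.\<close>
  have loc: "integrable lborel (\<lambda>x. (f x - P x - c) * indicator {a<..<b} x)"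
    and L2loc: "(\<lambda>x. (f x - P x - c) * indicator {a<..<b} x) \<in> L2" for a b
  proof -
    have "(\<lambda>x. (P x + c) * indicator {a<..<b} x) \<in> L2"
    proof -
      have "integrable lborel (\<lambda>x. indicator {a..b} x *\<^sub>R (P x + c)\<^sup>2)"
        by (intro borel_integrable_compact continuous_intros continuous_on_subset[OF P]) auto
      hence "integrable lborel (\<lambda>x. indicator {a..b} x *\<^sub>R (P x + c)\<^sup>2 * indicator {a<..<b} x)"
        by (intro integrable_real_mult_indicator) auto
      moreover have "(\<lambda>x. indicator {a..b} x *\<^sub>R (P x + c)\<^sup>2 * indicator {a<..<b} x)
          = (\<lambda>x. ((P x + c) * indicator {a<..<b} x)\<^sup>2)"
        by (auto simp: indicator_def fun_eq_iff)
      ultimately show ?thesis using mP by (simp add: L2_def)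
    qed
    moreover have "(\<lambda>x. f x * indicator {a<..<b} x) \<in> L2"
    proof -
      have "integrable lborel (\<lambda>x. (f x)\<^sup>2 * indicator {a<..<b} x)"
        by (intro integrable_real_mult_indicator L2_sq_integrable f) auto
      moreover have "(\<lambda>x. (f x)\<^sup>2 * indicator {a<..<b} x) = (\<lambda>x. (f x * indicator {a<..<b} x)\<^sup>2)"
        by (auto simp: indicator_def fun_eq_iff)
      ultimately show ?thesis using mf by (simp add: L2_def)
    qed
    ultimately have "(\<lambda>x. f x * indicator {a<..<b} x + (-1) * ((P x + c) * indicator {a<..<b} x)) \<in> L2"
      by (intro L2_add L2_scale)
    thus L: "(\<lambda>x. (f x - P x - c) * indicator {a<..<b} x) \<in> L2"
      by (simp add: algebra_simps)
    have "integrable lborel (\<lambda>x. (f x - P x - c) * indicator {a<..<b} x * indicator {a<..<b} x)"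
      by (rule L2_mult_indicator_integrable[OF L])
    thus "integrable lborel (\<lambda>x. (f x - P x - c) * indicator {a<..<b} x)"
      by (simp add: mult.assoc flip: indicator_inter_arith)
  qed
  \<comment> \<open>The passage from cutoffs to indicators as in
    \<open>integral_interval_zero\<close>, repeated for a function that need not be in
    \<open>L2\<close>.\<close>
  have zero: "(LINT x|lborel. (f x - P x - c) * indicator {a<..<b} x) = 0" for a b
  proof -
    have "(\<lambda>n. LINT x|lborel. (f x - P x - c) * cutoff a b (real n) x)
        \<longlonglongrightarrow> (LINT x|lborel. (f x - P x - c) * indicator {a<..<b} x)"
    proof (rule integral_dominated_convergence)
      show "integrable lborel (\<lambda>x. \<bar>(f x - P x - c) * indicator {a<..<b} x\<bar>)"
        by (intro integrable_abs loc)
      show "(\<lambda>x. (f x - P x - c) * indicator {a<..<b} x) \<in> borel_measurable lborel"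
        using mf mP by measurable
      show "(\<lambda>x. (f x - P x - c) * cutoff a b (real n) x) \<in> borel_measurable lborel" for n
        using mf mP L2_measurable[OF C1c_L2[OF cutoff_C1c[of "real n" a b]]] by simp
      show "AE x in lborel. (\<lambda>n. (f x - P x - c) * cutoff a b (real n) x)
          \<longlonglongrightarrow> (f x - P x - c) * indicator {a<..<b} x"
        by (intro AE_I2 tendsto_mult_left cutoff_tendsto)
      show "AE x in lborel. norm ((f x - P x - c) * cutoff a b (real n) x)
          \<le> \<bar>(f x - P x - c) * indicator {a<..<b} x\<bar>" for n
        by (intro AE_I2) (auto simp: abs_mult intro!: mult_left_mono cutoff_bound)
    qed
    thus ?thesis by (simp add: test LIMSEQ_const_iff)
  qed
  have "AE x in lborel. (f x - P x - c) * indicator {-real n<..<real n} x = 0" for n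
  proof (rule integral_interval_zero_AE[OF L2loc])
    fix a b
    have "(\<lambda>x. (f x - P x - c) * indicator {-real n<..<real n} x * indicator {a<..<b} x)
        = (\<lambda>x. (f x - P x - c) * indicator {max (-real n) a<..<min (real n) b} x)"
      by (auto simp: indicator_def fun_eq_iff)
    thus "(LINT x|lborel. (f x - P x - c) * indicator {-real n<..<real n} x * indicator {a<..<b} x) = 0"
      by (simp add: zero)
  qed
  hence "AE x in lborel. \<forall>n. (f x - P x - c) * indicator {-real n<..<real n} x = 0"
    by (subst AE_all_countable) blast
  hence "AE x in lborel. f x = P x + c"
  proof (rule AE_mp, intro AE_I2 impI)
    fix x :: real assume *: "\<forall>n. (f x - P x - c) * indicator {-real n<..<real n} x = 0"
    obtain n where "\<bar>x\<bar> < real n" using reals_Archimedean2 by blast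
    hence "x \<in> {-real n<..<real n}" by auto
    thus "f x = P x + c" using *[rule_format, of n] by simp
  qed
  thus thesis by (rule that)
qed

text \<open>The oriented indicator: \<open>primitive v x\<close> is the integral of \<open>v\<close> from 0 to \<open>x\<close>, with a minus sign
  for negative \<open>x\<close>. As a kernel it is directly amenable to Fubini's theorem.\<close>

definition primitive_kernel :: "real \<Rightarrow> real \<Rightarrow> real" where
  "primitive_kernel x t = indicator {..x} t * indicator {0<..} t - indicator {x<..} t * indicator {..0} t"

definition primitive :: "(real \<Rightarrow> real) \<Rightarrow> real \<Rightarrow> real" where
  "primitive v x = (LINT t|lborel. v t * primitive_kernel x t)"

lemma primitive_kernel_le:
  assumes "\<bar>x\<bar> < R" shows "\<bar>primitive_kernel x t\<bar> \<le> indicator {-R<..<R} t"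
  using assms by (auto simp: primitive_kernel_def indicator_def)

lemma primitive_kernel_measurable:
  "(\<lambda>z. primitive_kernel (fst z) (snd z)) \<in> borel_measurable (borel \<Otimes>\<^sub>M borel)"
proof -
  have "(\<lambda>z. primitive_kernel (fst z) (snd z)) = (\<lambda>z::real \<times> real.
      (if snd z \<le> fst z then 1 else 0) * (if 0 < snd z then 1 else 0)
      - (if fst z < snd z then 1 else 0) * (if snd z \<le> 0 then 1 else 0))"
    by (auto simp: primitive_kernel_def indicator_def fun_eq_iff)
  thus ?thesis by simp
qed

lemma primitive_kernel_measurable_snd: "primitive_kernel x \<in> borel_measurable borel"
  unfolding primitive_kernel_def[abs_def] by measurable

text \<open>Dominated convergence: along a bounded sequence all kernels live in one interval, and
  for \<open>t \<noteq> x\<close> their values at \<open>t\<close> are eventually constant, so the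
  exceptional set is a single point.\<close>

lemma primitive_continuous:
  assumes v: "v \<in> L2"
  shows "continuous_on UNIV (primitive v)"
proof -
  have mv: "v \<in> borel_measurable borel" by (rule L2_measurable[OF v])
  have "(\<lambda>n. primitive v (X n)) \<longlonglongrightarrow> primitive v x" if X: "X \<longlonglongrightarrow> x" for X x
  proof -
    obtain R where R: "\<And>n. \<bar>X n\<bar> < R"
      using convergent_imp_Bseq[OF convergentI[OF X]] unfolding Bseq_def
      by (metis real_norm_def gt_ex le_less_trans)
    show ?thesis unfolding primitive_def
    proof (rule integral_dominated_convergence)
      show "integrable lborel (\<lambda>t. \<bar>v t\<bar> * indicator {-R<..<R} t)"
        by (intro L2_mult_indicator_integrable L2_abs v)
      show "(\<lambda>t. v t * primitive_kernel x t) \<in> borel_measurable lborel"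
        "(\<lambda>t. v t * primitive_kernel (X n) t) \<in> borel_measurable lborel" for n
        using mv primitive_kernel_measurable_snd by auto
      show "AE t in lborel. norm (v t * primitive_kernel (X n) t) \<le> \<bar>v t\<bar> * indicator {-R<..<R} t" for n
        using primitive_kernel_le[OF R] by (auto simp: abs_mult intro!: mult_left_mono)
      show "AE t in lborel. (\<lambda>n. v t * primitive_kernel (X n) t) \<longlonglongrightarrow> v t * primitive_kernel x t"
        using AE_lborel_singleton[of x]
      proof eventually_elim
        case (elim t)
        have "\<forall>\<^sub>F n in sequentially. primitive_kernel (X n) t = primitive_kernel x t"
        proof (cases "t < x")
          case True
          show ?thesis using order_tendstoD(1)[OF X True]
            by eventually_elim (use True in \<open>auto simp: primitive_kernel_def indicator_def\<close>)
        next
          case False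
          hence xt: "x < t" using elim by simp
          show ?thesis using order_tendstoD(2)[OF X xt]
            by eventually_elim (use xt in \<open>auto simp: primitive_kernel_def indicator_def\<close>)
        qed
        thus ?case by (intro tendsto_mult_left tendsto_eventually)
      qed
    qed
  qed
  thus ?thesis by (auto simp: continuous_on_sequentially o_def)
qed

text \<open>Integrating in \<open>x\<close> first leaves \<open>deriv \<phi>\<close> on a right
  half-line for \<open>t > 0\<close> and on a left one for \<open>t \<le> 0\<close>; the sign in the
  kernel makes both cases yield \<open>- \<phi> t\<close>.\<close>

lemma primitive_by_parts:
  assumes v: "v \<in> L2" and \<phi>: "\<phi> \<in> C1c"
  shows "(LINT x|lborel. primitive v x * deriv \<phi> x) = - (LINT x|lborel. v x * \<phi> x)"
proof -
  obtain R where R: "0 < R" "\<And>x. R \<le> \<bar>x\<bar> \<Longrightarrow> \<phi> x = 0" "\<And>x. R \<le> \<bar>x\<bar> \<Longrightarrow> deriv \<phi> x = 0"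
    using C1c_support[OF \<phi>] by blast
  let ?K = "\<lambda>x t. v t * primitive_kernel x t * deriv \<phi> x"
  have mv: "v \<in> borel_measurable borel" by (rule L2_measurable[OF v])
  have m\<phi>: "deriv \<phi> \<in> borel_measurable borel" by (rule L2_measurable[OF C1c_deriv_L2[OF \<phi>]])
  have bd: "\<bar>?K x t\<bar> \<le> \<bar>v t\<bar> * indicator {-R<..<R} t * \<bar>deriv \<phi> x\<bar>" for x t
  proof (cases "\<bar>x\<bar> < R")
    case True
    from primitive_kernel_le[OF this] show ?thesis
      by (auto simp: abs_mult intro!: mult_right_mono mult_left_mono)
  qed (simp add: R)
  have iv: "integrable lborel (\<lambda>t. \<bar>v t\<bar> * indicator {-R<..<R} t)"
    by (intro L2_mult_indicator_integrable L2_abs v)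
  have "integrable (lborel \<Otimes>\<^sub>M lborel) (\<lambda>(x, t). \<bar>v t\<bar> * indicator {-R<..<R} t * \<bar>deriv \<phi> x\<bar>)"
  proof (rule lborel_pair.Fubini_integrable)
    show "(\<lambda>(x, t). \<bar>v t\<bar> * indicator {-R<..<R} t * \<bar>deriv \<phi> x\<bar>) \<in> borel_measurable (lborel \<Otimes>\<^sub>M lborel)"
      using mv m\<phi> by measurable
    show "AE x in lborel. integrable lborel (\<lambda>t. case (x, t) of (x, t) \<Rightarrow> \<bar>v t\<bar> * indicator {-R<..<R} t * \<bar>deriv \<phi> x\<bar>)"
      using iv by simp
    have "integrable lborel (\<lambda>x. (LINT t|lborel. \<bar>v t\<bar> * indicator {-R<..<R} t) * \<bar>deriv \<phi> x\<bar>)"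
      using C1c_deriv_integrable[OF \<phi>] by (intro integrable_mult_right integrable_abs)
    thus "integrable lborel (\<lambda>x. LINT t|lborel. norm (case (x, t) of (x, t) \<Rightarrow> \<bar>v t\<bar> * indicator {-R<..<R} t * \<bar>deriv \<phi> x\<bar>))"
      by (simp add: abs_mult)
  qed
  hence int: "integrable (lborel \<Otimes>\<^sub>M lborel) (\<lambda>(x, t). ?K x t)"
  proof (rule Bochner_Integration.integrable_bound)
    show "(\<lambda>(x, t). ?K x t) \<in> borel_measurable (lborel \<Otimes>\<^sub>M lborel)"
      using mv m\<phi> primitive_kernel_measurable unfolding split_beta' by measurable
  qed (use bd in auto)
  have "(LINT x|lborel. primitive v x * deriv \<phi> x) = (LINT x|lborel. LINT t|lborel. ?K x t)"
    by (simp add: primitive_def)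
  also have "\<dots> = (LINT t|lborel. LINT x|lborel. ?K x t)"
    by (rule lborel_pair.Fubini_integral[OF int, symmetric])
  also have "\<dots> = (LINT t|lborel. - (v t * \<phi> t))"
  proof (rule Bochner_Integration.integral_cong[OF refl])
    fix t
    show "(LINT x|lborel. ?K x t) = - (v t * \<phi> t)"
    proof (cases "0 < t")
      case True
      hence "(\<lambda>x. ?K x t) = (\<lambda>x. v t * (deriv \<phi> x * indicator {t..} x))"
        by (auto simp: primitive_kernel_def indicator_def fun_eq_iff)
      thus ?thesis by (simp add: C1c_integral_deriv_Ici[OF \<phi>])
    next
      case False
      hence "(\<lambda>x. ?K x t) = (\<lambda>x. - v t * (deriv \<phi> x * indicator {..<t} x))"
        by (auto simp: primitive_kernel_def indicator_def fun_eq_iff)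
      thus ?thesis by (simp add: C1c_integral_deriv_Iio[OF \<phi>])
    qed
  qed
  finally show ?thesis by simp
qed

text \<open>\<open>f\<close> and \<open>primitive v\<close> act alike on derivatives of test
  functions, hence differ by a constant almost everywhere.\<close>

lemma is_weak_deriv_imp_continuous:
  assumes f: "f \<in> L2" and v: "v \<in> L2" and d: "is_weak_deriv f v"
  obtains w where "continuous_on UNIV w" "AE x in lborel. f x = w x"
proof -
  obtain c where "AE x in lborel. f x = primitive v x + c"
    using du_Bois_Reymond[OF f primitive_continuous[OF v]] d v primitive_by_parts
    unfolding is_weak_deriv_def by metis
  thus thesis
    using that continuous_on_add[OF primitive_continuous[OF v] continuous_on_const] by blast
qed

lemma is_weak_deriv_continuous_imp_C1:
  assumes f: "f \<in> L2" and q: "continuous_on UNIV q"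
    and d: "\<And>\<phi>. \<phi> \<in> C1c \<Longrightarrow> (LINT x|lborel. f x * deriv \<phi> x) = - (LINT x|lborel. q x * \<phi> x)"
  obtains w where "\<And>x. (w has_real_derivative q x) (at x)" "AE x in lborel. f x = w x"
proof -
  obtain Q where Q: "\<And>x. (Q has_real_derivative q x) (at x)"
    using continuous_antiderivative[OF q] by blast
  have "continuous_on UNIV Q" using DERIV_continuous_on[OF has_field_derivative_at_within[OF Q]] .
  then obtain c where "AE x in lborel. f x = Q x + c"
    using du_Bois_Reymond[OF f, of Q] d C1_integral_by_parts[OF Q q] by metis
  moreover have "((\<lambda>x. Q x + c) has_real_derivative q x) (at x)" for x
    by (auto intro!: derivative_eq_intros Q)
  ultimately show thesis using that by blast
qed

text \<open>Bootstrap: a continuous representative \<open>w0\<close> of \<open>u\<close> makes the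
  weak second derivative continuous; so the weak derivative has a C1 representative
  \<open>w'\<close>, and \<open>u\<close> has a representative \<open>w\<close> with derivative
  \<open>w'\<close>.\<close>

lemma weak_solution_classical:
  assumes h: "continuous_on UNIV (ext0 g)" and sol: "weak_solution g lam u"
  obtains w w' where
    "\<And>x. (w has_real_derivative w' x) (at x)"
    "\<And>x. (w' has_real_derivative lam * w x - ext0 g (w x)) (at x)"
    "AE x in lborel. H1_fun u x = w x" "AE x in lborel. H1_deriv u x = w' x"
proof -
  have f: "H1_fun u \<in> L2" by (rule H1_funs_L2[OF H1_fun_in])
  have mf: "H1_fun u \<in> borel_measurable borel" by (rule L2_measurable[OF f])
  have v: "H1_deriv u \<in> L2" "is_weak_deriv (H1_fun u) (H1_deriv u)" by (rule H1_deriv_weak)+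
  obtain w0 where w0: "continuous_on UNIV w0" "AE x in lborel. H1_fun u x = w0 x"
    using is_weak_deriv_imp_continuous[OF f v] by blast
  have mw0: "w0 \<in> borel_measurable borel" using w0(1) by (rule borel_measurable_continuous_onI)
  have mh: "ext0 g \<in> borel_measurable borel" using h by (rule borel_measurable_continuous_onI)
  have chw: "continuous_on UNIV (\<lambda>x. ext0 g (w0 x))"
    using continuous_on_compose2[OF h w0(1)] by simp
  have eq: "(LINT x|lborel. H1_deriv u x * deriv \<phi> x) = - (LINT x|lborel. (lam * w0 x - ext0 g (w0 x)) * \<phi> x)"
    if \<phi>: "\<phi> \<in> C1c" for \<phi>
  proof -
    obtain R where R: "0 < R" "\<And>x. R \<le> \<bar>x\<bar> \<Longrightarrow> \<phi> x = 0" "\<And>x. R \<le> \<bar>x\<bar> \<Longrightarrow> deriv \<phi> x = 0"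
      using C1c_support[OF \<phi>] by blast
    have c\<phi>: "continuous_on UNIV \<phi>"
      using DERIV_continuous_on[OF has_field_derivative_at_within[OF C1cD(1)[OF \<phi>]]] .
    have m\<phi>: "\<phi> \<in> borel_measurable borel" using c\<phi> by (rule borel_measurable_continuous_onI)
    have i: "integrable lborel (\<lambda>x. w0 x * \<phi> x)" "integrable lborel (\<lambda>x. ext0 g (w0 x) * \<phi> x)"
      by (auto intro!: integrable_continuous_compact_support[where R = R] continuous_intros c\<phi> chw w0 simp: R)
    have 1: "(LINT x|lborel. H1_fun u x * \<phi> x) = (LINT x|lborel. w0 x * \<phi> x)"
      using w0(2) mf mw0 m\<phi> by (intro integral_cong_AE) auto
    have 2: "(LINT x|lborel. ext0 g (H1_fun u x) * \<phi> x) = (LINT x|lborel. ext0 g (w0 x) * \<phi> x)"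
      using w0(2) measurable_compose[OF mf mh] measurable_compose[OF mw0 mh] m\<phi>
      by (intro integral_cong_AE) auto
    have "(LINT x|lborel. (lam * w0 x - ext0 g (w0 x)) * \<phi> x)
        = (LINT x|lborel. lam * (w0 x * \<phi> x) - ext0 g (w0 x) * \<phi> x)"
      by (simp add: algebra_simps)
    also have "\<dots> = lam * (LINT x|lborel. w0 x * \<phi> x) - (LINT x|lborel. ext0 g (w0 x) * \<phi> x)"
      using i by simp
    also have "\<dots> = lam * (LINT x|lborel. H1_fun u x * \<phi> x) - (LINT x|lborel. ext0 g (H1_fun u x) * \<phi> x)"
      by (simp only: 1 2)
    also have "\<dots> = - (LINT x|lborel. H1_deriv u x * deriv \<phi> x)"
      using bspec[OF sol[unfolded weak_solution_def] \<phi>] by linarith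
    finally show ?thesis by simp
  qed
  have "continuous_on UNIV (\<lambda>x. lam * w0 x - ext0 g (w0 x))"
    by (intro continuous_intros w0 chw)
  then obtain w' where w': "\<And>x. (w' has_real_derivative lam * w0 x - ext0 g (w0 x)) (at x)"
      "AE x in lborel. H1_deriv u x = w' x"
    using is_weak_deriv_continuous_imp_C1[OF v(1) _ eq] by blast
  have cw': "continuous_on UNIV w'" using DERIV_continuous_on[OF has_field_derivative_at_within[OF w'(1)]] .
  have mw': "w' \<in> borel_measurable borel" using cw' by (rule borel_measurable_continuous_onI)
  have "(LINT x|lborel. H1_fun u x * deriv \<phi> x) = - (LINT x|lborel. w' x * \<phi> x)" if \<phi>: "\<phi> \<in> C1c" for \<phi>
  proof -
    have "(LINT x|lborel. H1_deriv u x * \<phi> x) = (LINT x|lborel. w' x * \<phi> x)"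
      using w'(2) mw' L2_measurable[OF v(1)] L2_measurable[OF C1c_L2[OF \<phi>]]
      by (intro integral_cong_AE) auto
    thus ?thesis using v(2) \<phi> by (simp add: is_weak_deriv_def)
  qed
  then obtain w where w: "\<And>x. (w has_real_derivative w' x) (at x)" "AE x in lborel. H1_fun u x = w x"
    using is_weak_deriv_continuous_imp_C1[OF f cw'] by blast
  \<comment> \<open>The equation obtained for \<open>w'\<close> still involves \<open>w0\<close>;
    continuity of both representatives closes the loop.\<close>
  have "w = w0"
  proof (rule continuous_AE_eq_imp_eq)
    show "continuous_on UNIV w" using DERIV_continuous_on[OF has_field_derivative_at_within[OF w(1)]] .
    show "AE x in lborel. w x = w0 x" using w(2) w0(2) by auto
  qed (rule w0)
  thus thesis using that w w' by blast
qed

section \<open>Behaviour at infinity of integrable functions\<close>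

lemma integrable_limit_zero:
  fixes p :: "real \<Rightarrow> real"
  assumes p: "integrable lborel p" and l: "(p \<longlongrightarrow> l) at_top"
  shows "l = 0"
proof (rule ccontr)
  assume "l \<noteq> 0"
  hence l0: "\<bar>l\<bar> / 2 < \<bar>l\<bar>" by simp
  have "\<forall>\<^sub>F x in at_top. \<bar>l\<bar> / 2 < \<bar>p x\<bar>"
    by (rule order_tendstoD(1)[OF tendsto_rabs[OF l] l0])
  then obtain R where R: "\<And>x. R \<le> x \<Longrightarrow> \<bar>l\<bar> / 2 < \<bar>p x\<bar>"
    unfolding eventually_at_top_linorder by blast
  have "\<bar>l\<bar> / 2 * real n \<le> (LINT x|lborel. \<bar>p x\<bar>)" for n
  proof -
    have "(LINT x|lborel. \<bar>l\<bar> / 2 * indicator {R..R + real n} x) \<le> (LINT x|lborel. \<bar>p x\<bar>)"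
    proof (intro integral_mono integrable_abs p)
      show "integrable lborel (\<lambda>x. \<bar>l\<bar> / 2 * indicator {R..R + real n} x)"
        by (intro integrable_mult_right integrable_real_indicator) auto
      show "\<bar>l\<bar> / 2 * indicator {R..R + real n} x \<le> \<bar>p x\<bar>" for x
        using R[of x] by (cases "R \<le> x") (auto simp: indicator_def)
    qed
    thus ?thesis by simp
  qed
  moreover obtain n where "(LINT x|lborel. \<bar>p x\<bar>) / (\<bar>l\<bar> / 2) < real n"
    using reals_Archimedean2 by blast
  hence "(LINT x|lborel. \<bar>p x\<bar>) < \<bar>l\<bar> / 2 * real n"
    using \<open>l \<noteq> 0\<close> by (simp add: field_simps)
  ultimately show False by (meson not_le)
qed

text \<open>Integrability of \<open>p'\<close> makes \<open>p\<close> converge, and integrability of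
  \<open>p\<close> makes the limit 0. It will be applied to \<open>w\<^sup>2\<close>, whose
  derivative is integrable as a product of \<open>L2\<close> functions.\<close>

lemma integrable_deriv_tendsto_zero:
  fixes p p' :: "real \<Rightarrow> real"
  assumes d: "\<And>x. (p has_real_derivative p' x) (at x)" and c: "continuous_on UNIV p'"
    and p: "integrable lborel p" and p': "integrable lborel p'"
  shows "(p \<longlongrightarrow> 0) at_top"
proof -
  have "integrable lborel (\<lambda>x. p' x * indicator {0..} x)"
    using p' by (intro integrable_real_mult_indicator) auto
  from tendsto_integral_at_top[OF _ this]
  have "((\<lambda>y. LINT x|lborel. indicator {..y} x *\<^sub>R (p' x * indicator {0..} x)) \<longlongrightarrow>
      (LINT x|lborel. p' x * indicator {0..} x)) at_top" (is "(?I \<longlongrightarrow> ?L) at_top") by simp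
  moreover have "\<forall>\<^sub>F y in at_top. ?I y = p y - p 0"
  proof (rule eventually_at_top_linorderI[of 0])
    fix y :: real assume y: "0 \<le> y"
    have "(\<lambda>x. indicator {..y} x *\<^sub>R (p' x * indicator {0..} x)) = (\<lambda>x. p' x * indicator {0..y} x)"
      by (auto simp: indicator_def fun_eq_iff)
    thus "?I y = p y - p 0"
      using integral_FTC_Icc_real[OF y, of p p'] d c by (simp add: continuous_on_eq_continuous_at)
  qed
  ultimately have "((\<lambda>y. p y - p 0) \<longlongrightarrow> ?L) at_top" by (rule Lim_transform_eventually)
  hence "((\<lambda>y. p y - p 0 + p 0) \<longlongrightarrow> ?L + p 0) at_top" by (intro tendsto_intros)
  hence "(p \<longlongrightarrow> ?L + p 0) at_top" by simp
  thus ?thesis using integrable_limit_zero[OF p] by metis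
qed


section \<open>Continuity in $H^1$\<close>

lemma L2_cong_AE:
  assumes u: "u \<in> L2" and v: "v \<in> borel_measurable borel" and ae: "AE x in lborel. u x = v x"
  shows "v \<in> L2"
proof -
  have "integrable lborel (\<lambda>x. (v x)\<^sup>2) \<longleftrightarrow> integrable lborel (\<lambda>x. (u x)\<^sup>2)"
    using ae v L2_measurable[OF u] by (intro integrable_cong_AE) auto
  thus ?thesis using u v by (simp add: L2_def)
qed

text \<open>\<open>H1_fun\<close> chooses a representative of each class, so it respects the
  operations of \<open>H1\<close> only almost everywhere.\<close>

lemma H1_fun_abs: "w \<in> H1_funs \<Longrightarrow> AE x in lborel. H1_fun (abs_H1 w) x = w x"
  using Quotient3_rep_abs[OF Quotient3_H1, of w] by (simp add: H1_rel_def H1_fun_def)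

lemma H1_fun_zero: "AE x in lborel. H1_fun 0 x = 0"
  using H1_fun_abs[OF H1_funs_zero] by (simp add: zero_H1_def)

lemma H1_fun_add: "AE x in lborel. H1_fun (u + v) x = H1_fun u x + H1_fun v x"
  using H1_fun_abs[OF H1_funs_add[OF H1_fun_in H1_fun_in]] by (simp add: plus_H1_def H1_fun_def)

lemma H1_fun_scaleR: "AE x in lborel. H1_fun (c *\<^sub>R u) x = c * H1_fun u x"
  using H1_fun_abs[OF H1_funs_scale[OF H1_fun_in]] by (simp add: scaleR_H1_def H1_fun_def)

lemma H1_fun_diff: "AE x in lborel. H1_fun (u - v) x = H1_fun u x - H1_fun v x"
proof -
  have e: "u - v = u + (-1) *\<^sub>R v" by simp
  show ?thesis unfolding e
    using H1_fun_add[of u "(-1) *\<^sub>R v"] H1_fun_scaleR[of "-1" v] by eventually_elim simp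
qed

lemma H1_deriv_diff: "AE x in lborel. H1_deriv (u - v) x = H1_deriv u x - H1_deriv v x"
proof -
  let ?w = "\<lambda>x. H1_fun u x + (-1) * H1_fun v x" and ?d = "\<lambda>x. H1_deriv u x + (-1) * H1_deriv v x"
  have L: "?w \<in> L2" "?d \<in> L2"
    by (intro L2_add L2_scale H1_funs_L2 H1_fun_in H1_deriv_weak)+
  have wd: "is_weak_deriv ?w ?d"
    by (intro is_weak_deriv_add is_weak_deriv_scale L2_scale H1_funs_L2 H1_fun_in H1_deriv_weak)
  have "is_weak_deriv (H1_fun (u - v)) ?d"
    by (rule is_weak_deriv_cong_AE[OF L(1) H1_funs_L2[OF H1_fun_in] _ wd])
      (use H1_fun_diff[of u v] in \<open>auto elim: eventually_mono\<close>)
  from weak_deriv_eqI[OF H1_funs_L2[OF H1_fun_in] L(2) this] show ?thesis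
    by (simp add: H1_deriv_def)
qed

text \<open>Lets the distance be computed from the classical functions instead of the chosen
  representatives.\<close>

lemma H1_norm_diff:
  assumes m: "w \<in> borel_measurable borel" "w' \<in> borel_measurable borel"
      "z \<in> borel_measurable borel" "z' \<in> borel_measurable borel"
    and u: "AE x in lborel. H1_fun u x = w x" "AE x in lborel. H1_deriv u x = w' x"
    and v: "AE x in lborel. H1_fun v x = z x" "AE x in lborel. H1_deriv v x = z' x"
  shows "norm (u - v) = sqrt ((LINT x|lborel. (w x - z x)\<^sup>2) + (LINT x|lborel. (w' x - z' x)\<^sup>2))"
proof -
  have "(LINT x|lborel. (H1_fun (u - v) x)\<^sup>2) = (LINT x|lborel. (w x - z x)\<^sup>2)"
    using H1_fun_diff[of u v] u(1) v(1) m L2_measurable[OF H1_funs_L2[OF H1_fun_in]]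
    by (intro integral_cong_AE) auto
  moreover have "(LINT x|lborel. (H1_deriv (u - v) x)\<^sup>2) = (LINT x|lborel. (w' x - z' x)\<^sup>2)"
    using H1_deriv_diff[of u v] u(2) v(2) m L2_measurable[OF H1_deriv_weak(1)]
    by (intro integral_cong_AE) auto
  ultimately show ?thesis by (simp add: H1_norm_eq)
qed

lemma integrable_exp_neg_abs:
  fixes c :: real
  assumes c: "0 < c"
  shows "integrable lborel (\<lambda>x. exp (- (c * \<bar>x\<bar>)))"
proof -
  let ?h = "\<lambda>x. indicator {0..} x * exp (- (c * x))"
  have "(\<lambda>x. exp (- (c * x))) integrable_on {0..}"
    using has_integral_exp_minus_to_infinity[OF c, of 0] by (auto simp: integrable_on_def)
  hence "(\<lambda>x. exp (- (c * x))) absolutely_integrable_on {0..}"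
    by (intro nonnegative_absolutely_integrable_1) auto
  hence i: "integrable lborel ?h"
    unfolding set_integrable_def by (subst (asm) integrable_completion) auto
  \<comment> \<open>The sum of \<open>?h\<close> and its reflection is the two-sided exponential
    except at 0, where it is 2; it serves as a bound.\<close>
  have "integrable lborel (\<lambda>x. ?h x + ?h (0 + (-1) * x))"
    by (rule Bochner_Integration.integrable_add[OF i lborel_integrable_real_affine[OF i]]) simp
  thus ?thesis
    by (rule Bochner_Integration.integrable_bound) (auto simp: indicator_def)
qed

lemma (in scalar_field) weak_solution_ground_state:
  assumes f: "f = ext0 g" and lam: "0 < lam" and sol: "weak_solution g lam u"
    and ev: "H1_even u" and nz: "u \<noteq> 0"
  obtains w w' where "ground_state lam w w'"
    "AE x in lborel. H1_fun u x = w x" "AE x in lborel. H1_deriv u x = w' x"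
proof -
  have cf: "continuous_on UNIV (ext0 g)"
    using DERIV_continuous_on[OF has_field_derivative_at_within[OF f_deriv]] f by simp
  obtain w w' where w: "\<And>x. (w has_real_derivative w' x) (at x)"
    and w': "\<And>x. (w' has_real_derivative lam * w x - f (w x)) (at x)"
    and ae: "AE x in lborel. H1_fun u x = w x" "AE x in lborel. H1_deriv u x = w' x"
    using weak_solution_classical[OF cf sol, folded f] by blast
  have s: "solution lam w w'" using w w' by (simp add: solution_def)
  have c: "continuous_on UNIV w" "continuous_on UNIV w'" by (rule solutionD[OF s])+
  have m: "w \<in> borel_measurable borel" "w' \<in> borel_measurable borel"
    using c by (auto intro: borel_measurable_continuous_onI)
  have u: "H1_fun u \<in> L2" by (rule H1_funs_L2[OF H1_fun_in])
  have L: "w \<in> L2" "w' \<in> L2"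
    using L2_cong_AE[OF u m(1) ae(1)] L2_cong_AE[OF H1_deriv_weak(1) m(2) ae(2)] by auto
  \<comment> \<open>Evenness of the class is an almost-everywhere statement; continuity of
    \<open>w\<close> then extends it to every point.\<close>
  have "AE x in lborel. w (- x) = w x"
    using AE_reflect[OF L2_measurable[OF u] m(1) ae(1)] ae(1) ev[unfolded H1_even_def] by eventually_elim simp
  moreover have "continuous_on UNIV (\<lambda>x. w (- x))"
    by (rule continuous_on_compose2[OF c(1)]) (auto intro!: continuous_intros)
  ultimately have "(\<lambda>x. w (- x)) = w" using continuous_AE_eq_imp_eq c(1) by blast
  hence even: "w (- x) = w x" for x by (rule fun_cong)
  have "((\<lambda>x. (w x)\<^sup>2) \<longlongrightarrow> 0) at_top"
  proof (rule integrable_deriv_tendsto_zero)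
    show "((\<lambda>x. (w x)\<^sup>2) has_real_derivative 2 * (w x * w' x)) (at x)" for x
      by (auto intro!: derivative_eq_intros w)
    show "integrable lborel (\<lambda>x. (w x)\<^sup>2)" "integrable lborel (\<lambda>x. 2 * (w x * w' x))"
      using L by (auto intro!: L2_sq_integrable L2_mult_integrable)
  qed (intro continuous_intros c)
  from tendsto_real_sqrt[OF this] have "((\<lambda>x. \<bar>w x\<bar>) \<longlongrightarrow> 0) at_top" by simp
  hence lim: "(w \<longlongrightarrow> 0) at_top" by (simp only: tendsto_rabs_zero_iff)
  \<comment> \<open>As \<open>w\<close> tends to 0, the conserved energy \<open>E\<close> is the
    limit of \<open>w'\<^sup>2\<close> at infinity, and integrability of \<open>w'\<^sup>2\<close>
    forces \<open>E = 0\<close>.\<close>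
  define E where "E = (w' 0)\<^sup>2 - lam * (w 0)\<^sup>2 + 2 * F (w 0)"
  have en: "(w' x)\<^sup>2 = E + lam * (w x)\<^sup>2 - 2 * F (w x)" for x
    using energy_constant[OF s, of x 0] by (simp add: E_def)
  have "((\<lambda>x. F (w x)) \<longlongrightarrow> F 0) at_top"
    using isCont_tendsto_compose[OF DERIV_isCont[OF F_deriv] lim] .
  hence "((\<lambda>x. E + lam * (w x)\<^sup>2 - 2 * F (w x)) \<longlongrightarrow> E + lam * 0\<^sup>2 - 2 * 0) at_top"
    using lim F_0 by (intro tendsto_intros) auto
  hence "((\<lambda>x. (w' x)\<^sup>2) \<longlongrightarrow> E) at_top" unfolding en by simp
  from integrable_limit_zero[OF L2_sq_integrable[OF L(2)] this] have E: "E = 0" .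
  have "\<exists>x. w x \<noteq> 0"
  proof (rule ccontr)
    assume "\<not> (\<exists>x. w x \<noteq> 0)"
    hence "AE x in lborel. H1_fun u x = H1_fun 0 x"
      using ae(1) H1_fun_zero by (auto elim: eventually_elim2)
    thus False using nz by (simp add: H1_eq_iff[symmetric])
  qed
  hence "ground_state lam w w'"
    unfolding ground_state_def using lam s even lim en E by simp
  thus thesis using that ae by blast
qed

lemma (in scalar_field) ground_state_H1_continuous:
  fixes W W' :: "real \<Rightarrow> real \<Rightarrow> real" and U :: "real \<Rightarrow> H1"
  assumes gs: "\<And>lam. 0 < lam \<Longrightarrow> ground_state lam (W lam) (W' lam)"
    and ae: "\<And>lam. 0 < lam \<Longrightarrow> AE x in lborel. H1_fun (U lam) x = W lam x"
      "\<And>lam. 0 < lam \<Longrightarrow> AE x in lborel. H1_deriv (U lam) x = W' lam x"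
    and a: "0 < a"
  shows "(U \<longlongrightarrow> U a) (at a)"
  unfolding tendsto_at_iff_sequentially
proof (intro allI impI)
  fix X :: "nat \<Rightarrow> real" assume X: "\<forall>i. X i \<in> UNIV - {a}" "X \<longlonglongrightarrow> a"
  hence fX: "filterlim X (at a) sequentially" by (simp add: filterlim_at)
  obtain C c where c: "0 < c" and
    ev: "\<forall>\<^sub>F lam in at a. \<forall>x. \<bar>W lam x\<bar> \<le> C * exp (- (c * \<bar>x\<bar>)) \<and> \<bar>W' lam x\<bar> \<le> C * exp (- (c * \<bar>x\<bar>))"
    and ba: "\<forall>x. \<bar>W a x\<bar> \<le> C * exp (- (c * \<bar>x\<bar>)) \<and> \<bar>W' a x\<bar> \<le> C * exp (- (c * \<bar>x\<bar>))"
    using gs_uniform_decay[OF gs a] by blast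
  have "\<forall>\<^sub>F lam in at a. 0 < lam"
    using order_tendstoD(1)[OF tendsto_ident_at a] .
  from eventually_conj[OF ev this] have "\<forall>\<^sub>F n in sequentially.
      (\<forall>x. \<bar>W (X n) x\<bar> \<le> C * exp (- (c * \<bar>x\<bar>)) \<and> \<bar>W' (X n) x\<bar> \<le> C * exp (- (c * \<bar>x\<bar>))) \<and> 0 < X n"
    by (rule eventually_compose_filterlim[OF _ fX])
  then obtain N where N: "\<And>n. N \<le> n \<Longrightarrow>
      (\<forall>x. \<bar>W (X n) x\<bar> \<le> C * exp (- (c * \<bar>x\<bar>)) \<and> \<bar>W' (X n) x\<bar> \<le> C * exp (- (c * \<bar>x\<bar>))) \<and> 0 < X n"
    unfolding eventually_sequentially by blast
  \<comment> \<open>Dropping \<open>N\<close> terms makes positivity and the decay bounds hold for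
    every index, as dominated convergence requires.\<close>
  define Y where "Y n = X (n + N)" for n
  have Y: "0 < Y n" and bW: "\<bar>W (Y n) x\<bar> \<le> C * exp (- (c * \<bar>x\<bar>))"
    and bW': "\<bar>W' (Y n) x\<bar> \<le> C * exp (- (c * \<bar>x\<bar>))" for n x
    using N[of "n + N"] by (auto simp: Y_def)
  have fY: "filterlim Y (at a) sequentially"
    using X LIMSEQ_ignore_initial_segment[OF X(2), of N] by (simp add: filterlim_at Y_def[abs_def])
  have m: "W lam \<in> borel_measurable borel" "W' lam \<in> borel_measurable borel" if "0 < lam" for lam
    using solutionD(3,4)[OF gs_sol[OF gs[OF that]]] by (auto intro: borel_measurable_continuous_onI)
  \<comment> \<open>Stated for a generic \<open>V\<close> to serve both \<open>W\<close> and
    \<open>W'\<close>; the dominating function is the square of twice the common decay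
    bound.\<close>
  have dom: "(\<lambda>n. LINT x|lborel. (V (Y n) x - V a x)\<^sup>2) \<longlonglongrightarrow> integral\<^sup>L lborel (\<lambda>_::real. 0::real)"
    if mV: "\<And>lam. 0 < lam \<Longrightarrow> V lam \<in> borel_measurable borel"
      and tV: "\<And>x. ((\<lambda>lam. V lam x) \<longlongrightarrow> V a x) (at a)"
      and bV: "\<And>n x. \<bar>V (Y n) x\<bar> \<le> C * exp (- (c * \<bar>x\<bar>))" "\<And>x. \<bar>V a x\<bar> \<le> C * exp (- (c * \<bar>x\<bar>))"
    for V :: "real \<Rightarrow> real \<Rightarrow> real"
  proof (rule integral_dominated_convergence)
    show "integrable lborel (\<lambda>x. (2 * C)\<^sup>2 * exp (- ((2 * c) * \<bar>x\<bar>)))"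
      using c by (intro integrable_mult_right integrable_exp_neg_abs) simp
    show "(\<lambda>x. (V (Y n) x - V a x)\<^sup>2) \<in> borel_measurable lborel" for n
      using mV[OF Y[of n]] mV[OF a] by simp
    have "(\<lambda>n. (V (Y n) x - V a x)\<^sup>2) \<longlonglongrightarrow> (V a x - V a x)\<^sup>2" for x
      by (intro tendsto_intros filterlim_compose[OF tV fY])
    thus "AE x in lborel. (\<lambda>n. (V (Y n) x - V a x)\<^sup>2) \<longlonglongrightarrow> 0" by simp
    show "AE x in lborel. norm ((V (Y n) x - V a x)\<^sup>2) \<le> (2 * C)\<^sup>2 * exp (- ((2 * c) * \<bar>x\<bar>))" for n
    proof (intro AE_I2)
      fix x
      have "\<bar>V (Y n) x - V a x\<bar> \<le> 2 * C * exp (- (c * \<bar>x\<bar>))"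
        using bV(1)[of n x] bV(2)[of x] by linarith
      hence "\<bar>V (Y n) x - V a x\<bar>\<^sup>2 \<le> (2 * C * exp (- (c * \<bar>x\<bar>)))\<^sup>2"
        by (intro power_mono) auto
      also have "\<dots> = (2 * C)\<^sup>2 * exp (- ((2 * c) * \<bar>x\<bar>))"
        by (simp add: power_mult_distrib exp_double[symmetric] mult_ac)
      finally show "norm ((V (Y n) x - V a x)\<^sup>2) \<le> (2 * C)\<^sup>2 * exp (- ((2 * c) * \<bar>x\<bar>))" by simp
    qed
  qed simp
  have "(\<lambda>n. sqrt ((LINT x|lborel. (W (Y n) x - W a x)\<^sup>2) + (LINT x|lborel. (W' (Y n) x - W' a x)\<^sup>2)))
      \<longlonglongrightarrow> sqrt (integral\<^sup>L lborel (\<lambda>_::real. 0::real) + integral\<^sup>L lborel (\<lambda>_::real. 0::real))"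
    using ba by (intro tendsto_real_sqrt tendsto_add dom m bW bW' gs_tendsto[OF gs a]) auto
  moreover have "norm (U (Y n) - U a)
      = sqrt ((LINT x|lborel. (W (Y n) x - W a x)\<^sup>2) + (LINT x|lborel. (W' (Y n) x - W' a x)\<^sup>2))" for n
    by (intro H1_norm_diff m ae Y a)
  ultimately have "(\<lambda>n. norm (U (Y n) - U a)) \<longlonglongrightarrow> 0" by simp
  hence "(\<lambda>n. U (Y n)) \<longlonglongrightarrow> U a" by (simp only: tendsto_norm_zero_iff LIM_zero_iff)
  hence "(\<lambda>n. (U \<circ> X) (n + N)) \<longlonglongrightarrow> U a" by (simp add: Y_def)
  thus "(U \<circ> X) \<longlonglongrightarrow> U a" by (rule LIMSEQ_offset)
qed

text \<open>Only the point 0 needs care: the left derivative of the extension is 0 and the right one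
  is \<open>g' 0\<close>, and \<open>g' 0 = 0\<close> makes them agree.\<close>

lemma ext0_scalar_field:
  fixes g g' :: "real \<Rightarrow> real"
  assumes g_deriv: "\<And>s. 0 \<le> s \<Longrightarrow> (g has_real_derivative g' s) (at s within {0..})"
    and g'_cont: "continuous_on {0..} g'"
    and g_zero: "g 0 = 0" and g'_zero: "g' 0 = 0"
    and g_pos: "\<And>s. 0 < s \<Longrightarrow> 0 < g s"
  obtains F where "scalar_field (ext0 g) (ext0 g') F"
proof -
  have D: "(ext0 g has_real_derivative ext0 g' s) (at s)" for s
  proof -
    have right: "(ext0 g has_real_derivative g' s) (at s within {0..})" if "0 \<le> s"
    proof (rule has_field_derivative_transform_within[OF g_deriv[OF that], of 1])
      show "s \<in> {0..}" using that by simp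
      show "g y = ext0 g y" if "y \<in> {0..}" "dist y s < 1" for y
        using that g_zero by (auto simp: ext0_def)
    qed simp
    have left: "(ext0 g has_real_derivative 0) (at s within {..0})" if "s \<le> 0"
    proof (rule has_field_derivative_transform_within[OF DERIV_const[of 0], of 1])
      show "s \<in> {..0}" using that by simp
      show "0 = ext0 g y" if "y \<in> {..0}" "dist y s < 1" for y
        using that by (simp add: ext0_def)
    qed simp
    show ?thesis
    proof (cases s "0 :: real" rule: linorder_cases)
      case less
      hence "s \<in> interior {..0}" by simp
      from at_within_interior[OF this] show ?thesis using left less by (simp add: ext0_def)
    next
      case greater
      hence "s \<in> interior {0..}" by simp
      from at_within_interior[OF this] show ?thesis using right greater by (simp add: ext0_def)
    next
      case equal
      \<comment> \<open>The two-sided filter at 0 is the join of the one-sided ones, so two equal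
        one-sided limits of the difference quotient suffice.\<close>
      have at_s: "at s = sup (at s within {..0}) (at s within {0..})"
        by (subst at_within_union[symmetric]) (simp add: Un_def linorder_linear)
      have "((\<lambda>y. (ext0 g y - ext0 g s) / (y - s)) \<longlongrightarrow> ext0 g' s)
          (sup (at s within {..0}) (at s within {0..}))"
        using left right equal g'_zero
        by (simp add: has_field_derivative_iff filterlim_sup ext0_def[of g'])
      thus ?thesis by (simp only: has_field_derivative_iff at_s[symmetric])
    qed
  qed
  have c: "continuous_on UNIV (ext0 g')"
  proof -
    have "continuous_on UNIV (\<lambda>s. if s \<le> 0 then 0 else g' s)"
      by (rule continuous_on_cases_le)
        (auto intro!: continuous_intros continuous_on_subset[OF g'_cont] simp: g'_zero)
    thus ?thesis by (simp add: ext0_def[abs_def])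
  qed
  have "continuous_on UNIV (ext0 g)"
    using DERIV_continuous_on[OF has_field_derivative_at_within[OF D]] .
  then obtain Q where Q: "\<And>x. (Q has_real_derivative ext0 g x) (at x)"
    using continuous_antiderivative by blast
  have "scalar_field (ext0 g) (ext0 g') (\<lambda>x. Q x - Q 0)"
    by unfold_locales (use D c g_pos in \<open>auto simp: ext0_def[of _ 0] intro!: derivative_eq_intros Q\<close>,
        auto simp: ext0_def)
  thus thesis by (rule that)
qed


theorem theorem6p6:
  fixes g g' :: "real \<Rightarrow> real" and \<alpha> \<beta> \<mu>\<^sub>1 \<mu>\<^sub>2 :: real and U :: "real \<Rightarrow> H1"
  assumes g_deriv: "\<And>s. 0 \<le> s \<Longrightarrow> (g has_real_derivative g' s) (at s within {0..})"
    and g'_cont: "continuous_on {0..} g'"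
    and g_zero: "g 0 = 0"
    and g_pos: "\<And>s. 0 < s \<Longrightarrow> 0 < g s"
    and \<alpha>: "2 < \<alpha>" and \<beta>: "2 < \<beta>"
    and \<mu>\<^sub>1: "0 < \<mu>\<^sub>1" and \<mu>\<^sub>2: "0 < \<mu>\<^sub>2"
    and lim_0: "((\<lambda>s. g' s / s powr (\<alpha> - 2)) \<longlongrightarrow> \<mu>\<^sub>1 * (\<alpha> - 1)) (at_right 0)"
    and lim_infinity: "((\<lambda>s. g' s / s powr (\<beta> - 2)) \<longlongrightarrow> \<mu>\<^sub>2 * (\<beta> - 1)) at_top"
    and U: "\<And>lam. 0 < lam \<Longrightarrow> weak_solution g lam (U lam) \<and> U lam \<noteq> 0 \<and> H1_even (U lam)"
  shows "continuous_on {0<..} U \<and> connected {(lam, U lam) | lam. lam \<in> {0<..}}"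
proof -
  \<comment> \<open>Near 0, \<open>g'\<close> is a convergent quotient times
    \<open>s powr (\<alpha> - 2)\<close>, which tends to 0 because \<alpha> > 2; continuity of
    \<open>g'\<close> identifies the limit.\<close>
  have "g' 0 = 0"
  proof -
    have "((\<lambda>s. s powr (\<alpha> - 2)) \<longlongrightarrow> 0) (at_right (0::real))"
      by (rule tendsto_zero_powrI[OF tendsto_ident_at tendsto_const])
        (use \<alpha> in \<open>auto simp: eventually_at_filter\<close>)
    from tendsto_mult[OF lim_0 this]
    have "((\<lambda>s. g' s / s powr (\<alpha> - 2) * s powr (\<alpha> - 2)) \<longlongrightarrow> 0) (at_right 0)" by simp
    moreover have "\<forall>\<^sub>F s in at_right 0. g' s / s powr (\<alpha> - 2) * s powr (\<alpha> - 2) = g' s"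
      by (auto simp: eventually_at_filter)
    ultimately have "(g' \<longlongrightarrow> 0) (at_right 0)" by (rule Lim_transform_eventually)
    moreover have "(g' \<longlongrightarrow> g' 0) (at_right 0)"
      using g'_cont by (auto simp: continuous_on_def intro: tendsto_within_subset[of _ _ _ "{0..}"])
    ultimately show ?thesis by (metis tendsto_unique trivial_limit_at_right_real)
  qed
  from ext0_scalar_field[OF g_deriv g'_cont g_zero this g_pos] obtain F
    where "scalar_field (ext0 g) (ext0 g') F" by blast
  then interpret scalar_field "ext0 g" "ext0 g'" F .
  have "\<exists>w w'. ground_state lam w w' \<and> (AE x in lborel. H1_fun (U lam) x = w x)
      \<and> (AE x in lborel. H1_deriv (U lam) x = w' x)" if lam: "0 < lam" for lam
    using weak_solution_ground_state[OF refl lam] U[OF lam] by metis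
  then obtain W W' where
    gs: "\<And>lam. 0 < lam \<Longrightarrow> ground_state lam (W lam) (W' lam)"
    and ae: "\<And>lam. 0 < lam \<Longrightarrow> AE x in lborel. H1_fun (U lam) x = W lam x"
      "\<And>lam. 0 < lam \<Longrightarrow> AE x in lborel. H1_deriv (U lam) x = W' lam x"
    by metis
  have "isCont U a" if "0 < a" for a
    unfolding isCont_def by (rule ground_state_H1_continuous[OF gs ae that])
  hence c: "continuous_on {0<..} U"
    by (simp add: continuous_on_eq_continuous_at)
  \<comment> \<open>The graph is the image of a connected half-line under a continuous map into the
    product space.\<close>
  have "connected ((\<lambda>lam. (lam, U lam)) ` {0<..})"
    by (intro connected_continuous_image continuous_on_Pair continuous_on_id c connected_Ioi)
  moreover have "(\<lambda>lam. (lam, U lam)) ` {0<..} = {(lam, U lam) | lam. lam \<in> {0<..}}" by blast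
  ultimately show ?thesis using c by simp
qed

end
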